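(* Let $F$ be a left-invariant Lorentz force on the Heisenberg group $H_3$ endowed with its canonical metric. Then any two periodic magnetic trajectories for $F$ with the same energy are equivalent under the action of $H_F\ltimes\mathbb{R}$; that is, if $\sigma_1,\sigma_2:\mathbb{R}\to H_3$ are periodic magnetic trajectories for $F$ with the same energy, there exist $(\psi,r)\in H_F$ and $s\in\mathbb{R}$ such that $\sigma_2=((\psi,r),s)\cdot\sigma_1$.
   Context: The Heisenberg group $H_3$ is $\mathbb{R}^3$ with product $(x_1,y_1,z_1)(x_2,y_2,z_2)=(x_1+x_2,\,y_1+y_2,\,z_1+z_2+\tfrac12(x_1y_2-x_2y_1))$. The canonical metric is the left-invariant metric for which the left-invariant fields $e_1=\partial_x-\tfrac12 y\,\partial_z$, $e_2=\partial_y+\tfrac12 x\,\partial_z$, $e_3=\partial_z$ are orthonormal. A left-invariant Lorentz force is a left-invariant skew-symmetric $(1,1)$-tensor $F$ whose 2-form $\langle F\cdot,\cdot\rangle$ is closed. A magnetic trajectory is a curve $\gamma:\mathbb{R}\to H_3$ with $\nabla_{\gamma'}\gamma'=F\gamma'$; its energy is $\tfrac12|\gamma'(0)|^2$. It is periodic if $\gamma(t+\omega)=\gamma(t)$ for all $t$, for some $\omega>0$. The group $\mathrm{Iso}(H_3)\times\mathbb{R}^*$ acts on Lorentz forces by $(\psi,r)\cdot F=r\,\psi_*\circ F\circ\psi_*^{-1}$ and on differentiable curves by $((\psi,r)\cdot\gamma)(t)=\psi(\gamma(rt))$. $H_F$ is the isotropy subgroup of $F$: $H_F=\{(\psi,r):(\psi,r)\cdot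 F=F\}$. Elements $(g,s)$, $g\in H_F$, $s\in\mathbb{R}$, of $H_F\ltimes\mathbb{R}$ act on curves by $((g,s)\cdot\gamma)(t)=(g\cdot\gamma)(t+s)$. *)

theory Defs
  imports "HOL-Analysis.Analysis"
begin

section \<open>Calculus on a coordinate space\<close>

text \<open>
  All manifolds here are a single chart \<open>real ^ 'n\<close>, so every tangent space is identified
  with \<open>real ^ 'n\<close> itself, through the coordinate vector fields.
\<close>

abbreviation differential ::
    "(real ^ 'n \<Rightarrow> real ^ 'm) \<Rightarrow> real ^ 'n \<Rightarrow> real ^ 'n \<Rightarrow> real ^ 'm" where
  "differential \<psi> p \<equiv> frechet_derivative \<psi> (at p)"

abbreviation velocity :: "(real \<Rightarrow> real ^ 'n) \<Rightarrow> real \<Rightarrow> real ^ 'n" where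
  "velocity \<gamma> t \<equiv> vector_derivative \<gamma> (at t)"

text \<open>Class \<open>C\<^sup>k\<close>: continuous for \<open>k = 0\<close>; otherwise differentiable, with all directional
  derivatives of class \<open>C\<^sup>k\<^sup>-\<^sup>1\<close>.\<close>

primrec C_class :: "nat \<Rightarrow> (real ^ 'n \<Rightarrow> real ^ 'm) \<Rightarrow> bool" where
  "C_class 0 f \<longleftrightarrow> continuous_on UNIV f"
| "C_class (Suc k) f \<longleftrightarrow>
     (\<forall>p. f differentiable (at p)) \<and> (\<forall>v. C_class k (\<lambda>p. differential f p v))"

definition smooth :: "(real ^ 'n \<Rightarrow> real ^ 'm) \<Rightarrow> bool" where
  "smooth f \<longleftrightarrow> (\<forall>k. C_class k f)"

definition diffeomorphism :: "(real ^ 'n \<Rightarrow> real ^ 'n) \<Rightarrow> bool" where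
  "diffeomorphism \<psi> \<longleftrightarrow> bij \<psi> \<and> smooth \<psi> \<and> smooth (inv \<psi>)"

text \<open>Closedness of a 2-form, with \<open>d\<omega>\<close> evaluated on constant (hence commuting) fields.\<close>

definition closed_2form :: "(real ^ 'n \<Rightarrow> real ^ 'n \<Rightarrow> real ^ 'n \<Rightarrow> real) \<Rightarrow> bool" where
  "closed_2form \<omega> \<longleftrightarrow>
     (\<forall>u v p. (\<lambda>q. \<omega> q u v) differentiable (at p)) \<and>
     (\<forall>p u v w. frechet_derivative (\<lambda>q. \<omega> q v w) (at p) u
              + frechet_derivative (\<lambda>q. \<omega> q w u) (at p) v
              + frechet_derivative (\<lambda>q. \<omega> q u v) (at p) w = 0)"

section \<open>Riemannian metrics on a coordinate space\<close>

text \<open>A metric is given as \<open>g p u v\<close>, for \<open>u\<close>, \<open>v\<close> tangent at \<open>p\<close>.\<close>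

type_synonym 'n metric = "real ^ 'n \<Rightarrow> real ^ 'n \<Rightarrow> real ^ 'n \<Rightarrow> real"

definition gram :: "'n metric \<Rightarrow> real ^ 'n \<Rightarrow> real ^ 'n ^ 'n" where
  "gram g p = (\<chi> i j. g p (axis i 1) (axis j 1))"

definition partial_gram :: "'n::finite metric \<Rightarrow> real ^ 'n \<Rightarrow> 'n \<Rightarrow> 'n \<Rightarrow> 'n \<Rightarrow> real" where
  "partial_gram g p i j l = frechet_derivative (\<lambda>q. gram g q $ j $ l) (at p) (axis i 1)"

text \<open>Christoffel symbols \<open>\<Gamma>\<^sup>k\<^sub>i\<^sub>j\<close> of the Levi-Civita connection.\<close>

definition christoffel :: "'n::finite metric \<Rightarrow> real ^ 'n \<Rightarrow> 'n \<Rightarrow> 'n \<Rightarrow> 'n \<Rightarrow> real" where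
  "christoffel g p k i j =
     (1/2) * (\<Sum>l\<in>UNIV. matrix_inv (gram g p) $ k $ l *
        (partial_gram g p i j l + partial_gram g p j i l - partial_gram g p l i j))"

text \<open>The covariant acceleration \<open>\<nabla>\<^bsub>\<gamma>'\<^esub> \<gamma>'\<close>.\<close>

definition covariant_acceleration ::
    "'n::finite metric \<Rightarrow> (real \<Rightarrow> real ^ 'n) \<Rightarrow> real \<Rightarrow> real ^ 'n" where
  "covariant_acceleration g \<gamma> t = velocity (velocity \<gamma>) t +
     (\<chi> k. \<Sum>i\<in>UNIV. \<Sum>j\<in>UNIV. christoffel g (\<gamma> t) k i j * velocity \<gamma> t $ i * velocity \<gamma> t $ j)"

definition isometry :: "'n::finite metric \<Rightarrow> (real ^ 'n \<Rightarrow> real ^ 'n) \<Rightarrow> bool" where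
  "isometry g \<psi> \<longleftrightarrow> diffeomorphism \<psi> \<and>
     (\<forall>p u v. g (\<psi> p) (differential \<psi> p u) (differential \<psi> p v) = g p u v)"

section \<open>The Heisenberg group with its canonical metric\<close>

definition heis_mult :: "real ^ 3 \<Rightarrow> real ^ 3 \<Rightarrow> real ^ 3" where
  "heis_mult a b =
     vector [a$1 + b$1, a$2 + b$2, a$3 + b$3 + (1/2) * (a$1 * b$2 - b$1 * a$2)]"

definition heis_e1 :: "real ^ 3 \<Rightarrow> real ^ 3" where
  "heis_e1 p = vector [1, 0, - (1/2) * p$2]"

definition heis_e2 :: "real ^ 3 \<Rightarrow> real ^ 3" where
  "heis_e2 p = vector [0, 1, (1/2) * p$1]"

definition heis_e3 :: "real ^ 3 \<Rightarrow> real ^ 3" where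
  "heis_e3 p = vector [0, 0, 1]"

text \<open>Coefficients of a tangent vector at \<open>p\<close> in the left-invariant frame, see
  \<open>heis_frame_expansion\<close>. The metric declares that frame orthonormal.\<close>

definition heis_coeffs :: "real ^ 3 \<Rightarrow> real ^ 3 \<Rightarrow> real ^ 3" where
  "heis_coeffs p u = vector [u$1, u$2, u$3 + (1/2) * (p$2 * u$1 - p$1 * u$2)]"

definition heis_metric :: "3 metric" where
  "heis_metric p u v = heis_coeffs p u \<bullet> heis_coeffs p v"

lemma heis_frame_expansion:
  "u = heis_coeffs p u $ 1 *\<^sub>R heis_e1 p + heis_coeffs p u $ 2 *\<^sub>R heis_e2 p
     + heis_coeffs p u $ 3 *\<^sub>R heis_e3 p"
  by (simp add: vec_eq_iff forall_3 heis_coeffs_def heis_e1_def heis_e2_def heis_e3_def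
      algebra_simps)

lemma linear_heis_coeffs: "linear (heis_coeffs p)"
  by (rule linearI)
     (simp_all add: vec_eq_iff forall_3 heis_coeffs_def algebra_simps)

lemma heis_metric_frame:
  "heis_metric p (heis_e1 p) (heis_e1 p) = 1"
  "heis_metric p (heis_e2 p) (heis_e2 p) = 1"
  "heis_metric p (heis_e3 p) (heis_e3 p) = 1"
  "heis_metric p (heis_e1 p) (heis_e2 p) = 0"
  "heis_metric p (heis_e1 p) (heis_e3 p) = 0"
  "heis_metric p (heis_e2 p) (heis_e3 p) = 0"
  by (simp_all add: heis_metric_def heis_coeffs_def heis_e1_def heis_e2_def heis_e3_def
      inner_vec_def sum_3 algebra_simps)

lemma differential_heis_mult:
  "differential (heis_mult a) p =
     (\<lambda>v. vector [v$1, v$2, v$3 + (1/2) * (a$1 * v$2 - v$1 * a$2)])"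
proof -
  let ?L = "\<lambda>v::real^3. (vector [v$1, v$2, v$3 + (1/2) * (a$1 * v$2 - v$1 * a$2)] :: real^3)"
  have "linear ?L"
    by (rule linearI) (simp_all add: vec_eq_iff forall_3 algebra_simps)
  then have "((\<lambda>q. a + ?L q) has_derivative ?L) (at p)"
    using has_derivative_add[OF has_derivative_const linear_imp_has_derivative] by simp
  moreover have "heis_mult a = (\<lambda>q. a + ?L q)"
    by (simp add: fun_eq_iff heis_mult_def vec_eq_iff forall_3)
  ultimately have "(heis_mult a has_derivative ?L) (at p)"
    by simp
  then show ?thesis
    by (rule frechet_derivative_at[symmetric])
qed

lemma heis_frame_left_invariant:
  "differential (heis_mult a) p (heis_e1 p) = heis_e1 (heis_mult a p)"
  "differential (heis_mult a) p (heis_e2 p) = heis_e2 (heis_mult a p)"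
  "differential (heis_mult a) p (heis_e3 p) = heis_e3 (heis_mult a p)"
  by (simp_all add: differential_heis_mult heis_mult_def heis_e1_def heis_e2_def heis_e3_def
      vec_eq_iff forall_3 algebra_simps)

section \<open>Lorentz forces and magnetic trajectories\<close>

text \<open>A (1,1)-tensor field is given as \<open>F p v\<close>, for \<open>v\<close> tangent at \<open>p\<close>.\<close>

type_synonym tensor11 = "real ^ 3 \<Rightarrow> real ^ 3 \<Rightarrow> real ^ 3"

definition left_invariant :: "tensor11 \<Rightarrow> bool" where
  "left_invariant F \<longleftrightarrow>
     (\<forall>a p v. F (heis_mult a p) (differential (heis_mult a) p v)
            = differential (heis_mult a) p (F p v))"

definition left_invariant_lorentz_force :: "tensor11 \<Rightarrow> bool" where
  "left_invariant_lorentz_force F \<longleftrightarrow>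
     (\<forall>p. linear (F p)) \<and>
     left_invariant F \<and>
     (\<forall>p u v. heis_metric p (F p u) v = - heis_metric p u (F p v)) \<and>
     closed_2form (\<lambda>p u v. heis_metric p (F p u) v)"

definition magnetic_trajectory :: "tensor11 \<Rightarrow> (real \<Rightarrow> real ^ 3) \<Rightarrow> bool" where
  "magnetic_trajectory F \<gamma> \<longleftrightarrow>
     (\<forall>t. \<gamma> differentiable (at t)) \<and>
     (\<forall>t. velocity \<gamma> differentiable (at t)) \<and>
     (\<forall>t. covariant_acceleration heis_metric \<gamma> t = F (\<gamma> t) (velocity \<gamma> t))"

definition energy :: "(real \<Rightarrow> real ^ 3) \<Rightarrow> real" where
  "energy \<gamma> = (1/2) * heis_metric (\<gamma> 0) (velocity \<gamma> 0) (velocity \<gamma> 0)"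

definition periodic :: "(real \<Rightarrow> 'a) \<Rightarrow> bool" where
  "periodic \<gamma> \<longleftrightarrow> (\<exists>\<omega>>0. \<forall>t. \<gamma> (t + \<omega>) = \<gamma> t)"

section \<open>The group actions\<close>

definition iso_scale :: "((real ^ 3 \<Rightarrow> real ^ 3) \<times> real) set" where
  "iso_scale = {(\<psi>, r). isometry heis_metric \<psi> \<and> r \<noteq> 0}"

text \<open>\<open>r \<psi>\<^sub>* \<circ> F \<circ> \<psi>\<^sub>*\<^sup>-\<^sup>1\<close>, evaluated on a tangent vector \<open>v\<close> at \<open>q\<close>.\<close>

fun act_force :: "(real ^ 3 \<Rightarrow> real ^ 3) \<times> real \<Rightarrow> tensor11 \<Rightarrow> tensor11" where
  "act_force (\<psi>, r) F = (\<lambda>q v.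
     r *\<^sub>R differential \<psi> (inv \<psi> q) (F (inv \<psi> q) (differential (inv \<psi>) q v)))"

fun act_curve ::
    "(real ^ 3 \<Rightarrow> real ^ 3) \<times> real \<Rightarrow> (real \<Rightarrow> real ^ 3) \<Rightarrow> real \<Rightarrow> real ^ 3" where
  "act_curve (\<psi>, r) \<gamma> = (\<lambda>t. \<psi> (\<gamma> (r * t)))"

definition isotropy :: "tensor11 \<Rightarrow> ((real ^ 3 \<Rightarrow> real ^ 3) \<times> real) set" where
  "isotropy F = {g \<in> iso_scale. act_force g F = F}"

fun act_curve_shift ::
    "((real ^ 3 \<Rightarrow> real ^ 3) \<times> real) \<times> real \<Rightarrow> (real \<Rightarrow> real ^ 3) \<Rightarrow> real \<Rightarrow> real ^ 3" where
  "act_curve_shift (g, s) \<gamma> = (\<lambda>t. act_curve g \<gamma> (t + s))"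

end

theory Submission
  imports Defs
begin

text \<open>
  In the left-invariant frame the force is \<open>u \<mapsto> w \<times> u\<close> for a constant \<open>w\<close>, and up to a left translation
  a trajectory is determined by its frame velocity \<open>u\<close>. It therefore suffices to show that periodic
  trajectories of equal energy have the same \<open>u\<close> up to a time shift; the element of \<open>H\<^sub>F\<close> can be taken
  to be a left translation, with \<open>r = 1\<close>.

  If \<open>w\<^sub>1 = w\<^sub>2 = 0\<close>, then \<open>u\<close> rotates uniformly and closing up gives a quadratic equation for \<open>u\<^sub>3\<close> with
  only one admissible root. Otherwise, after rescaling to \<open>w\<^sub>1\<^sup>2 + w\<^sub>2\<^sup>2 = 1\<close>, the function \<open>s = u\<^sub>3 + w\<^sub>3\<close>
  satisfies \<open>s'\<^sup>2 = H - (s - \<rho>)\<^sup>2 - (K - s\<^sup>2/2)\<^sup>2\<close>, where \<open>H\<close> is twice the energy, \<open>\<rho> = w\<^sub>3\<close>, and the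
  curve closes up only if \<open>K - s\<^sup>2/2\<close> has mean zero. Writing the quartic as
  \<open>(D - (s - m)\<^sup>2) ((s + m)\<^sup>2 + B) / 4\<close>, so that \<open>s = m + \<surd>D cos \<phi>\<close>, all of \<open>m, D, B, K\<close> are explicit functions of
  \<open>\<sigma> = (D + B)/4\<close>, and the closing condition becomes \<open>I(\<sigma>) = 0\<close> for a complete elliptic integral \<open>I\<close>.
  Integration by parts shows that zeros of \<open>I\<close> lie in an interval on which, modulo exact forms,
  \<open>- \<sigma> I' = \<alpha> T + \<beta> I\<close> with \<open>T > 0\<close> and \<open>\<alpha> > 0\<close>. So \<open>I\<close> crosses zero only downwards, hence at most once,
  and \<open>\<sigma>\<close> is determined by \<open>\<rho>\<close> and \<open>H\<close>.
\<close>

section \<open>Uniqueness for second-order equations\<close>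

text \<open>The factor \<open>exp (- C * t)\<close> turns the bound into monotonicity: the product
  is nonincreasing, nonnegative and starts at 0.\<close>

lemma gronwall_zero:
  fixes f f' :: "real \<Rightarrow> real"
  assumes der: "\<And>t. (f has_real_derivative f' t) (at t)"
    and bound: "\<And>t. a \<le> t \<Longrightarrow> t \<le> b \<Longrightarrow> f' t \<le> C * f t"
    and nonneg: "\<And>t. 0 \<le> f t" and "f a = 0" "a \<le> b"
  shows "f b = 0"
proof -
  let ?g = "\<lambda>t. f t * exp (- C * t)"
  have "?g b \<le> ?g a"
  proof (rule DERIV_nonpos_imp_nonincreasing[OF \<open>a \<le> b\<close>])
    fix t assume t: "a \<le> t" "t \<le> b"
    have "(?g has_real_derivative (f' t - C * f t) * exp (- C * t)) (at t)"
      by (auto intro!: derivative_eq_intros der simp: algebra_simps)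
    moreover have "(f' t - C * f t) * exp (- C * t) \<le> 0"
      using bound[OF t] by (simp add: mult_nonpos_nonneg)
    ultimately show "\<exists>y. (?g has_real_derivative y) (at t) \<and> y \<le> 0" by blast
  qed
  then have "f b * exp (- C * b) \<le> 0" using \<open>f a = 0\<close> by simp
  then show ?thesis using nonneg[of b] by (simp add: mult_le_0_iff)
qed

text \<open>Gronwall for the squared distance of the two solutions. \<open>G\<close> is only locally
  Lipschitz, so a common bound for both solutions on the compact interval is fixed first. The factor
  \<open>\<theta>\<close> allows a change of the time variable, needed when an orbit is parametrised
  by an angle.\<close>

lemma second_order_ode_unique_forward:
  fixes s1 p1 s2 p2 \<theta> G :: "real \<Rightarrow> real"
  assumes s1: "\<And>t. (s1 has_real_derivative \<theta> t * p1 t) (at t)"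
    and p1: "\<And>t. (p1 has_real_derivative \<theta> t * G (s1 t)) (at t)"
    and s2: "\<And>t. (s2 has_real_derivative \<theta> t * p2 t) (at t)"
    and p2: "\<And>t. (p2 has_real_derivative \<theta> t * G (s2 t)) (at t)"
    and \<theta>: "continuous_on UNIV \<theta>"
    and lip: "\<And>M. \<exists>L. \<forall>a b. \<bar>a\<bar> \<le> M \<longrightarrow> \<bar>b\<bar> \<le> M \<longrightarrow> \<bar>G a - G b\<bar> \<le> L * \<bar>a - b\<bar>"
    and init: "s1 t0 = s2 t0" "p1 t0 = p2 t0" and "t0 \<le> t"
  shows "s1 t = s2 t \<and> p1 t = p2 t"
proof -
  have bdd: "\<exists>M. \<forall>\<tau>\<in>{t0..t}. \<bar>g \<tau>\<bar> \<le> M" if "continuous_on {t0..t} g" for g :: "real \<Rightarrow> real"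
    using compact_imp_bounded[OF compact_continuous_image[OF that compact_Icc]]
    by (auto simp: bounded_iff)
  have "continuous_on {t0..t} s1" "continuous_on {t0..t} s2"
    by (meson DERIV_continuous_on has_field_derivative_at_within s1 s2)+
  from bdd[OF this(1)] bdd[OF this(2)] obtain M1 M2
    where M1: "\<And>\<tau>. \<tau> \<in> {t0..t} \<Longrightarrow> \<bar>s1 \<tau>\<bar> \<le> M1" and M2: "\<And>\<tau>. \<tau> \<in> {t0..t} \<Longrightarrow> \<bar>s2 \<tau>\<bar> \<le> M2"
    by blast
  have "continuous_on {t0..t} \<theta>" using \<theta> continuous_on_subset by blast
  from bdd[OF this] obtain C where C: "\<And>\<tau>. \<tau> \<in> {t0..t} \<Longrightarrow> \<bar>\<theta> \<tau>\<bar> \<le> C" by blast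
  obtain L0 where L0: "\<And>a b. \<bar>a\<bar> \<le> max M1 M2 \<Longrightarrow> \<bar>b\<bar> \<le> max M1 M2 \<Longrightarrow> \<bar>G a - G b\<bar> \<le> L0 * \<bar>a - b\<bar>"
    using lip[of "max M1 M2"] by blast
  \<comment> \<open>\<open>L0\<close> may be negative if the bound is 0; the absolute value keeps
    the products below monotone.\<close>
  define L where "L = \<bar>L0\<bar>"
  have L: "\<bar>G a - G b\<bar> \<le> L * \<bar>a - b\<bar>" if "\<bar>a\<bar> \<le> max M1 M2" "\<bar>b\<bar> \<le> max M1 M2" for a b
    using L0[OF that] by (smt (verit) L_def abs_ge_zero mult_right_mono)
  let ?f = "\<lambda>t. (s1 t - s2 t)^2 + (p1 t - p2 t)^2"
  let ?f' = "\<lambda>t. 2 * \<theta> t * ((s1 t - s2 t) * (p1 t - p2 t) + (p1 t - p2 t) * (G (s1 t) - G (s2 t)))"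
  have "?f t = 0"
  proof (rule gronwall_zero[where f = ?f and f' = ?f' and a = t0 and C = "C * (1 + L)"])
    show "(?f has_real_derivative ?f' \<tau>) (at \<tau>)" for \<tau>
      by (auto intro!: derivative_eq_intros s1 s2 p1 p2 simp: algebra_simps)
    show "?f t0 = 0" using init by simp
    fix \<tau> assume "t0 \<le> \<tau>" "\<tau> \<le> t"
    then have \<tau>: "\<tau> \<in> {t0..t}" by simp
    define x where "x = \<bar>s1 \<tau> - s2 \<tau>\<bar>"
    define y where "y = \<bar>p1 \<tau> - p2 \<tau>\<bar>"
    have G: "\<bar>G (s1 \<tau>) - G (s2 \<tau>)\<bar> \<le> L * x"
      unfolding x_def using M1[OF \<tau>] M2[OF \<tau>] by (intro L) auto
    have xy: "2 * (x * y) \<le> x^2 + y^2"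
      using sum_squares_bound[of x y] by simp
    have y0: "0 \<le> y" and L0: "0 \<le> L" by (auto simp: y_def L_def)
    have "?f' \<tau> \<le> \<bar>?f' \<tau>\<bar>" by simp
    also have "\<dots> = 2 * \<bar>\<theta> \<tau>\<bar> * \<bar>(s1 \<tau> - s2 \<tau>) * (p1 \<tau> - p2 \<tau>) + (p1 \<tau> - p2 \<tau>) * (G (s1 \<tau>) - G (s2 \<tau>))\<bar>"
      by (simp add: abs_mult)
    also have "\<dots> \<le> 2 * \<bar>\<theta> \<tau>\<bar> * (x * y + y * (L * x))"
    proof (intro mult_left_mono)
      have "\<bar>(s1 \<tau> - s2 \<tau>) * (p1 \<tau> - p2 \<tau>) + (p1 \<tau> - p2 \<tau>) * (G (s1 \<tau>) - G (s2 \<tau>))\<bar>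
        \<le> x * y + y * \<bar>G (s1 \<tau>) - G (s2 \<tau>)\<bar>"
        unfolding x_def y_def by (simp flip: abs_mult)
      also have "\<dots> \<le> x * y + y * (L * x)"
        using mult_left_mono[OF G y0] by simp
      finally show "\<bar>(s1 \<tau> - s2 \<tau>) * (p1 \<tau> - p2 \<tau>) + (p1 \<tau> - p2 \<tau>) * (G (s1 \<tau>) - G (s2 \<tau>))\<bar> \<le> x * y + y * (L * x)" .
    qed simp
    also have "\<dots> = \<bar>\<theta> \<tau>\<bar> * (1 + L) * (2 * (x * y))" by (simp add: algebra_simps)
    also have "\<dots> \<le> C * (1 + L) * (x^2 + y^2)"
      using C[OF \<tau>] L0 xy y0 by (intro mult_mono) (auto simp: x_def)
    finally show "?f' \<tau> \<le> C * (1 + L) * ?f \<tau>" by (simp add: x_def y_def)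
  qed (use \<open>t0 \<le> t\<close> in auto)
  then show ?thesis by (simp add: sum_power2_eq_zero_iff)
qed

text \<open>Times before \<open>t0\<close> follow by reversing time, which keeps the shape of the
  system and replaces \<open>\<theta> t\<close> by \<open>- \<theta> (- t)\<close>.\<close>

lemma second_order_ode_unique:
  fixes s1 p1 s2 p2 \<theta> G :: "real \<Rightarrow> real"
  assumes s1: "\<And>t. (s1 has_real_derivative \<theta> t * p1 t) (at t)"
    and p1: "\<And>t. (p1 has_real_derivative \<theta> t * G (s1 t)) (at t)"
    and s2: "\<And>t. (s2 has_real_derivative \<theta> t * p2 t) (at t)"
    and p2: "\<And>t. (p2 has_real_derivative \<theta> t * G (s2 t)) (at t)"
    and \<theta>: "continuous_on UNIV \<theta>"
    and lip: "\<And>M. \<exists>L. \<forall>a b. \<bar>a\<bar> \<le> M \<longrightarrow> \<bar>b\<bar> \<le> M \<longrightarrow> \<bar>G a - G b\<bar> \<le> L * \<bar>a - b\<bar>"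
    and init: "s1 t0 = s2 t0" "p1 t0 = p2 t0"
  shows "s1 t = s2 t \<and> p1 t = p2 t"
proof (cases "t0 \<le> t")
  case True
  then show ?thesis
    using second_order_ode_unique_forward[of s1 \<theta> p1 G s2 p2, OF s1 p1 s2 p2 \<theta> lip init] by blast
next
  case False
  have rev: "((\<lambda>t. f (- t)) has_real_derivative - \<theta> (- t) * g) (at t)"
    if "(f has_real_derivative \<theta> (- t) * g) (at (- t))" for f g t
  proof -
    have "(uminus has_real_derivative - 1) (at t)" by (auto intro!: derivative_eq_intros)
    from DERIV_chain2[OF _ this, of f, OF that] show ?thesis by simp
  qed
  have "s1 (- (- t)) = s2 (- (- t)) \<and> p1 (- (- t)) = p2 (- (- t))"
  proof (rule second_order_ode_unique_forward[where G = G and \<theta> = "\<lambda>t. - \<theta> (- t)"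
        and ?s1.0 = "\<lambda>t. s1 (- t)" and ?s2.0 = "\<lambda>t. s2 (- t)" and ?p1.0 = "\<lambda>t. p1 (- t)"
        and ?p2.0 = "\<lambda>t. p2 (- t)" and ?t0.0 = "- t0"])
    show "continuous_on UNIV (\<lambda>t. - \<theta> (- t))"
      by (intro continuous_intros continuous_on_compose2[OF \<theta>]) auto
    show "\<exists>L. \<forall>a b. \<bar>a\<bar> \<le> M \<longrightarrow> \<bar>b\<bar> \<le> M \<longrightarrow> \<bar>G a - G b\<bar> \<le> L * \<bar>a - b\<bar>" for M
      by (rule lip)
    show "- t0 \<le> - t" using False by simp
    show "((\<lambda>t. s1 (- t)) has_real_derivative - \<theta> (- \<tau>) * p1 (- \<tau>)) (at \<tau>)" for \<tau> by (rule rev[OF s1])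
    show "((\<lambda>t. s2 (- t)) has_real_derivative - \<theta> (- \<tau>) * p2 (- \<tau>)) (at \<tau>)" for \<tau> by (rule rev[OF s2])
    show "((\<lambda>t. p1 (- t)) has_real_derivative - \<theta> (- \<tau>) * G (s1 (- \<tau>))) (at \<tau>)" for \<tau> by (rule rev[OF p1])
    show "((\<lambda>t. p2 (- t)) has_real_derivative - \<theta> (- \<tau>) * G (s2 (- \<tau>))) (at \<tau>)" for \<tau> by (rule rev[OF p2])
  qed (simp_all add: init)
  then show ?thesis by simp
qed

text \<open>\<open>X\<close> gains the same amount in every period, so a nonzero gain would make it
  unbounded. For a horizontal coordinate as a function of the angle, this turns boundedness of a
  closed curve into a vanishing integral.\<close>

lemma integral_zero_of_bounded_primitive:
  fixes X f :: "real \<Rightarrow> real"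
  assumes der: "\<And>t. (X has_real_derivative f t) (at t)"
    and per: "\<And>t. f (t + 2 * pi) = f t" and bdd: "\<And>t. \<bar>X t\<bar> \<le> C"
  shows "integral {0..2*pi} f = 0"
proof -
  define c where "c = X (2 * pi) - X 0"
  have "((\<lambda>t. X (t + 2 * pi) - X t) has_real_derivative 0) (at t)" for t
  proof -
    have "((\<lambda>t. X (t + 2 * pi)) has_real_derivative f (t + 2 * pi)) (at t)"
      by (rule DERIV_shift[THEN iffD1, OF der])
    from DERIV_diff[OF this der[of t]] show ?thesis by (simp add: per)
  qed
  from DERIV_isconst_all[OF allI[OF this], of _ 0] have step: "X (t + 2 * pi) = X t + c" for t
    by (simp add: c_def algebra_simps)
  have iter: "X (real k * (2 * pi)) = X 0 + real k * c" for k
  proof (induction k)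
    case (Suc k)
    have "X (real (Suc k) * (2 * pi)) = X (real k * (2 * pi) + 2 * pi)" by (simp add: algebra_simps)
    also have "\<dots> = X (real k * (2 * pi)) + c" by (rule step)
    finally show ?case using Suc by (simp add: algebra_simps)
  qed simp
  have "c = 0"
  proof (rule ccontr)
    assume "c \<noteq> 0"
    then obtain k :: nat where "2 * C < real k * \<bar>c\<bar>"
      using reals_Archimedean3[of "\<bar>c\<bar>"] by auto
    moreover have "real k * \<bar>c\<bar> = \<bar>X (real k * (2 * pi)) - X 0\<bar>"
      by (simp add: iter abs_mult)
    moreover have "\<dots> \<le> 2 * C"
      using bdd[of "real k * (2 * pi)"] bdd[of 0] by linarith
    ultimately show False by simp
  qed
  moreover have "(f has_integral X (2 * pi) - X 0) {0..2*pi}"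
    using der by (intro fundamental_theorem_of_calculus)
      (auto simp: has_real_derivative_iff_has_vector_derivative[symmetric] intro: has_field_derivative_at_within)
  ultimately show ?thesis by (simp add: c_def integral_unique)
qed

section \<open>The sign of the crossing coefficient\<close>

text \<open>Substituting \<open>t = 1 + 2 n u + z\<close> leaves a polynomial without negative coefficients.\<close>

lemma crossing_polynomial_pos:
  fixes n u t :: real
  assumes "0 \<le> n" "0 < u" "0 \<le> t - 1 - 2*n*u"
  shows "0 < t^3 + 3*t^2*u + t*(u-1) + n*(2*(1-u)^2 + t*(-10+18*u-12*u^2) + t^2*(8-2*u))
    + n^2*(-1+13*u-24*u^2+12*u^3 + t*(-4-u-4*u^2) + 5*t^2)
    + n^3*(-2+12*u-18*u^2+8*u^3 + 2*t - 8*t*u)" (is "0 < ?A")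
proof -
  define z where "z = t - 1 - 2*n*u"
  have t: "t = 1 + 2*n*u + z" by (simp add: z_def)
  have "?A = 2*z + 3*z^2 + z^3 + 4*u + 7*u*z + 3*u*z^2 + 6*n*z + 8*n*z^2 + 16*n*u + 26*n*u*z
    + 4*n*u*z^2 + 4*n*u^2 + 6*n^2*z + 5*n^2*z^2 + 24*n^2*u + 31*n^2*u*z + 12*n^2*u^2 + 2*n^3*z
    + 16*n^3*u + 12*n^3*u*z + 12*n^3*u^2 + 4*n^4*u + 4*n^4*u^2"
    unfolding t by algebra
  also have "\<dots> > 0"
    using assms by (intro add_pos_nonneg add_nonneg_pos mult_nonneg_nonneg mult_pos_pos)
       (auto simp: z_def)
  finally show ?thesis .
qed

text \<open>This is the factor of the positive integral in the derivative of the closure integral.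
  Multiplied by the positive number \<open>\<Delta> * B * D * (1+n)\<close> it becomes 64 times the
  polynomial of \<open>crossing_polynomial_pos\<close> at \<open>t = \<sigma>^2\<close>,
  \<open>u = k/2\<close>.\<close>

lemma crossing_coefficient_pos:
  fixes n k \<sigma> B D \<tau> h \<epsilon> W b r \<Delta> \<beta> g :: real
  assumes B_def: "B = 2*(\<sigma>+1) - k" and D_def: "D = 2*(\<sigma>-1) + k"
    and \<tau>_def: "\<tau> = n*(\<sigma>^2-1+k)/(1+n)"
    and h_def: "h = (\<tau>-\<sigma>-\<sigma>^2)/B" and \<epsilon>_def: "\<epsilon> = (\<sigma>^2-\<sigma>-\<tau>)/D"
    and W_def: "W = 4*\<sigma> - 4*n"
    and b_def: "b = 4*n - h*B - h*k + \<epsilon>*(k-D)" and r_def: "r = 2*B + 2*h*B + 2*k - 2*k*\<epsilon>"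
    and \<Delta>: "0 < \<Delta>" and \<Delta>_def: "\<Delta> = W^2 + 16*n*B"
    and \<beta>\<Delta>: "\<beta> * \<Delta> = 4*n*r - W*b" and g\<Delta>: "g * \<Delta> = - 4*B*b - W*r"
    and n: "0 \<le> n" and k: "0 < k" and \<sigma>: "1 \<le> \<sigma>" and z: "0 \<le> \<sigma>^2 - 1 - n*k" and B: "0 < B"
  shows "0 < 2*(\<sigma>^2-\<tau>) + h*B - k*\<epsilon> - \<beta>*(k+B) - 2*n*g" (is "0 < ?\<alpha>")
proof -
  have D: "0 < D" using k \<sigma> by (simp add: D_def)
  define u where "u = k/2"
  have ku: "k = 2*u" and u: "0 < u" and z': "0 \<le> \<sigma>^2 - 1 - 2*n*u"
    using k z by (auto simp: u_def)
  have n1: "0 < 1 + n" using n by simp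
  define A where "A = (let t = \<sigma>^2 in t^3 + 3*t^2*u + t*(u-1) + n*(2*(1-u)^2 + t*(-10+18*u-12*u^2) + t^2*(8-2*u))
    + n^2*(-1+13*u-24*u^2+12*u^3 + t*(-4-u-4*u^2) + 5*t^2)
    + n^3*(-2+12*u-18*u^2+8*u^3 + 2*t - 8*t*u))"
  have A: "0 < A" unfolding A_def Let_def using crossing_polynomial_pos[OF n u z'] .
  \<comment> \<open>The fractions \<open>h\<close>, \<open>\<epsilon>\<close>, \<open>\<tau>\<close>
    enter only through these division-free products.\<close>
  have hB: "h * B = \<tau>-\<sigma>-\<sigma>^2" and \<epsilon>D: "\<epsilon> * D = \<sigma>^2-\<sigma>-\<tau>" and \<tau>n: "\<tau> * (1+n) = n*(\<sigma>^2-1+k)"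
    using B D n1 by (simp_all add: h_def \<epsilon>_def \<tau>_def)
  have "?\<alpha> * \<Delta> = (2*(\<sigma>^2-\<tau>) + h*B - k*\<epsilon>) * \<Delta> - (\<beta>*\<Delta>)*(k+B) - 2*n*(g*\<Delta>)"
    by algebra
  also have "\<dots> = (2*(\<sigma>^2-\<tau>) + h*B - k*\<epsilon>) * \<Delta> + b*(W*(k+B) + 8*n*B) + r*(2*n*W - 4*n*(k+B))"
    unfolding \<beta>\<Delta> g\<Delta> by algebra
  finally have 1: "?\<alpha> * \<Delta> = (2*(\<sigma>^2-\<tau>) + h*B - k*\<epsilon>) * \<Delta> + b*(W*(k+B) + 8*n*B) + r*(2*n*W - 4*n*(k+B))" .
  have bBD: "b * B * D = 4*n*B*D - (h*B)*B*D - (h*B)*k*D + (\<epsilon>*D)*(k-D)*B"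
    unfolding b_def by algebra
  have rBD: "r * B * D = 2*B*B*D + 2*(h*B)*B*D + 2*k*B*D - 2*k*(\<epsilon>*D)*B"
    unfolding r_def by algebra
  have "?\<alpha> * \<Delta> * B * D = (2*(\<sigma>^2-\<tau>) * B * D + (h*B)*B*D - k*(\<epsilon>*D)*B) * \<Delta>
      + (b*B*D)*(W*(k+B) + 8*n*B) + (r*B*D)*(2*n*W - 4*n*(k+B))"
    unfolding 1 by algebra
  also have "\<dots> = (2*(\<sigma>^2-\<tau>) * B * D + (\<tau>-\<sigma>-\<sigma>^2)*B*D - k*(\<sigma>^2-\<sigma>-\<tau>)*B) * \<Delta>
      + (4*n*B*D - (\<tau>-\<sigma>-\<sigma>^2)*B*D - (\<tau>-\<sigma>-\<sigma>^2)*k*D + (\<sigma>^2-\<sigma>-\<tau>)*(k-D)*B)*(W*(k+B) + 8*n*B)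
      + (2*B*B*D + 2*(\<tau>-\<sigma>-\<sigma>^2)*B*D + 2*k*B*D - 2*k*(\<sigma>^2-\<sigma>-\<tau>)*B)*(2*n*W - 4*n*(k+B))"
    (is "_ = ?P \<tau>")
    unfolding bBD rBD hB \<epsilon>D ..
  finally have 2: "?\<alpha> * \<Delta> * B * D = ?P \<tau>" .
  \<comment> \<open>\<open>?P\<close> is affine in its argument, so the denominator of
    \<open>\<tau>\<close> can be cleared using only the values at 0 and 1.\<close>
  have 3: "?P \<tau> = ?P 0 + \<tau> * (?P 1 - ?P 0)" by algebra
  have "?\<alpha> * \<Delta> * B * D * (1+n) = ?P 0 * (1+n) + n*(\<sigma>^2-1+k) * (?P 1 - ?P 0)"
    unfolding 2 3 \<tau>n[symmetric] by algebra
  also have "\<dots> = 64 * A"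
    unfolding A_def Let_def \<Delta>_def W_def B_def D_def ku by algebra
  finally have "?\<alpha> * (\<Delta> * B * D * (1+n)) = 64 * A" by (simp add: mult.assoc)
  moreover have "0 < \<Delta> * B * D * (1+n)" using \<Delta> B D n1 by simp
  ultimately show ?thesis using A
    by (metis mult_pos_pos zero_less_mult_pos2 zero_less_numeral)
qed

section \<open>The closure integral\<close>

lemma integral_pos_of_continuous:
  fixes f :: "real \<Rightarrow> real"
  assumes "continuous_on {a..b} f" "a < b" "\<And>x. x \<in> {a..b} \<Longrightarrow> 0 \<le> f x" "c \<in> {a..b}" "f c \<noteq> 0"
  shows "0 < integral {a..b} f"
  using integral_eq_0_iff[of a b f] integral_nonneg[of f "{a..b}"] assms
  by (metis integrable_continuous_real less_eq_real_def)

text \<open>Just after \<open>a\<close> the function is negative; just before the next zero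
  \<open>c\<close> it is positive, because that zero is crossed downwards too. The intermediate
  value theorem then gives a zero before \<open>c\<close>.\<close>

lemma no_two_zeros_of_downcrossing:
  fixes f f' :: "real \<Rightarrow> real"
  assumes der: "\<And>x. x \<in> {a..b} \<Longrightarrow> (f has_real_derivative f' x) (at x within {a..b})"
    and neg: "\<And>x. x \<in> {a..b} \<Longrightarrow> f x = 0 \<Longrightarrow> f' x < 0"
    and "a < b" "f a = 0" "f b = 0"
  shows False
proof -
  have cont: "continuous_on {a..b} f"
    using DERIV_continuous_on der by blast
  obtain d where d: "d > 0" "\<And>h. 0 < h \<Longrightarrow> a + h \<in> {a..b} \<Longrightarrow> h < d \<Longrightarrow> f (a + h) < f a"
    using has_real_derivative_neg_dec_right[OF der neg] assms by (metis atLeastAtMost_iff less_imp_le order_refl)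
  define e where "e = a + min d (b - a) / 2"
  have e: "a < e" "e < b" "f e < 0"
    using d(1) d(2)[of "e - a"] \<open>a < b\<close> \<open>f a = 0\<close> by (auto simp: e_def min_def field_simps)
  \<comment> \<open>Starting at \<open>e\<close>, where \<open>f\<close> is negative, keeps the zero
    \<open>a\<close> out of \<open>Z\<close>; closedness makes the infimum itself a zero.\<close>
  define Z where "Z = {x \<in> {e..b}. f x = 0}"
  have "closed Z" unfolding Z_def using cont e
    by (intro continuous_closed_preimage_constant) (auto elim: continuous_on_subset)
  moreover have "b \<in> Z" "bdd_below Z" using e \<open>f b = 0\<close> by (auto simp: Z_def bdd_below_def)
  ultimately have InfZ: "Inf Z \<in> Z" by (intro closed_contains_Inf) auto
  define c where "c = Inf Z"
  have c: "e < c" "c \<le> b" "f c = 0" using InfZ e unfolding Z_def c_def by (auto simp: less_le)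
  have least: "c \<le> x" if "x \<in> Z" for x
    unfolding c_def using that \<open>bdd_below Z\<close> by (rule cInf_lower)
  obtain d' where d': "d' > 0" "\<And>h. 0 < h \<Longrightarrow> c - h \<in> {a..b} \<Longrightarrow> h < d' \<Longrightarrow> f c < f (c - h)"
    using has_real_derivative_neg_dec_left[OF der neg] c e by (metis atLeastAtMost_iff less_imp_le order_trans)
  define x where "x = c - min d' (c - e) / 2"
  have x: "e < x" "x < c" "0 < f x"
    using d'(1) d'(2)[of "c - x"] c e by (auto simp: x_def min_def field_simps)
  have "continuous_on {e..x} f" using cont by (rule continuous_on_subset) (use x c e in auto)
  then obtain w where "e \<le> w" "w \<le> x" "f w = 0"
    using IVT'[of f e 0 x] e x by auto
  then have "w \<in> Z" using x c by (auto simp: Z_def)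
  from least[OF this] \<open>w \<le> x\<close> \<open>x < c\<close> show False by simp
qed

text \<open>The integral of \<open>K - s\<^sup>2/2\<close> over one period, in the angle \<open>\<phi>\<close> with \<open>s = m + d cos \<phi>\<close> and
  \<open>ds/dt = - d sin \<phi> \<surd>q / 2\<close>, where \<open>q = (s + m)\<^sup>2 + B\<close> and \<open>k = 2 K - m\<^sup>2\<close>.\<close>

definition closure_integral :: "real \<Rightarrow> real \<Rightarrow> real \<Rightarrow> real \<Rightarrow> real" where
  "closure_integral m d B k = integral {0..2*pi}
     (\<lambda>\<phi>. (k + 2*m*(2*m + d * cos \<phi>) - (2*m + d * cos \<phi>)^2) / sqrt ((2*m + d * cos \<phi>)^2 + B))"

text \<open>The rule for working modulo exact forms: the derivative of a function with equal values
  at 0 and \<open>2*pi\<close> has integral zero.\<close>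

lemma integral_eq_of_exact_difference:
  fixes f g h h' :: "real \<Rightarrow> real"
  assumes "\<And>\<phi>. (h has_real_derivative h' \<phi>) (at \<phi>)" "h 0 = h (2*pi)"
    and "\<And>\<phi>. f \<phi> = g \<phi> + h' \<phi>" and "continuous_on {0..2*pi} g"
  shows "integral {0..2*pi} f = integral {0..2*pi} g"
proof -
  have "(h' has_integral h (2*pi) - h 0) {0..2*pi}"
    using assms(1) by (intro fundamental_theorem_of_calculus)
      (auto simp: has_real_derivative_iff_has_vector_derivative[symmetric] intro: has_field_derivative_at_within)
  then have "(h' has_integral 0) {0..2*pi}" using assms(2) by simp
  from has_integral_add[OF integrable_integral[OF integrable_continuous_real[OF assms(4)]] this]
  have "((\<lambda>\<phi>. g \<phi> + h' \<phi>) has_integral integral {0..2*pi} g) {0..2*pi}" by simp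
  then show ?thesis unfolding assms(3)[symmetric] by (rule integral_unique)
qed

text \<open>With \<open>(d * sin \<phi>)^2 = d^2 - (y \<phi> - 2*m)^2\<close> both derivatives
  become polynomials in \<open>y \<phi>\<close> over the 3/2 power of
  \<open>(y \<phi>)^2 + B\<close>.\<close>

lemma closure_exact_form:
  fixes m d B :: real
  defines "y \<equiv> \<lambda>\<phi>. 2*m + d * cos \<phi>"
  assumes q: "0 < (y \<phi>)^2 + B"
  shows "((\<lambda>\<phi>. d * sin \<phi> / sqrt ((y \<phi>)^2 + B)) has_real_derivative
      (2*m*(y \<phi>)^2 + (B + d^2 - 4*m^2) * y \<phi> - 2*m*B) / (((y \<phi>)^2 + B) * sqrt ((y \<phi>)^2 + B))) (at \<phi>)" (is ?th1)
    and "((\<lambda>\<phi>. d * sin \<phi> * y \<phi> / sqrt ((y \<phi>)^2 + B)) has_real_derivative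
      ((y \<phi>)^4 - 2*m*(y \<phi>)^3 + 2*B*(y \<phi>)^2 - 6*m*B*y \<phi> + B*(4*m^2 - d^2)) / (((y \<phi>)^2 + B) * sqrt ((y \<phi>)^2 + B))) (at \<phi>)" (is ?th2)
proof -
  define r where "r = sqrt ((y \<phi>)^2 + B)"
  have r: "0 < r" "r^2 = (y \<phi>)^2 + B" using q by (simp_all add: r_def)
  have dy: "(y has_real_derivative - (d * sin \<phi>)) (at \<phi>)"
    unfolding y_def by (auto intro!: derivative_eq_intros)
  have dr: "((\<lambda>\<phi>. sqrt ((y \<phi>)^2 + B)) has_real_derivative y \<phi> * (- (d * sin \<phi>)) / r) (at \<phi>)"
  proof -
    have "((\<lambda>\<phi>. (y \<phi>)^2 + B) has_real_derivative 2 * y \<phi> * (- (d * sin \<phi>))) (at \<phi>)"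
      by (rule derivative_eq_intros dy refl | simp)+
    from DERIV_chain2[OF DERIV_real_sqrt[OF q] this] show ?thesis
      by (simp add: r_def field_simps)
  qed
  have dc: "d * cos \<phi> = y \<phi> - 2*m" by (simp add: y_def)
  have ds: "(d * sin \<phi>)^2 = d^2 - (y \<phi> - 2*m)^2"
    unfolding dc[symmetric] by (simp add: power_mult_distrib sin_squared_eq algebra_simps)
  have "((\<lambda>\<phi>. d * sin \<phi> / sqrt ((y \<phi>)^2 + B)) has_real_derivative
     ((d * cos \<phi>) * r - d * sin \<phi> * (y \<phi> * (- (d * sin \<phi>)) / r)) / (r * r)) (at \<phi>)"
  proof -
    have "((\<lambda>\<phi>. d * sin \<phi>) has_real_derivative d * cos \<phi>) (at \<phi>)"
      by (rule derivative_eq_intros refl)+ simp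
    from DERIV_divide[OF this dr] r(1) show ?thesis by (simp add: r_def)
  qed
  moreover have "((d * cos \<phi>) * r - d * sin \<phi> * (y \<phi> * (- (d * sin \<phi>)) / r)) / (r * r)
     = ((y \<phi> - 2*m) * r^2 + (d * sin \<phi>)^2 * y \<phi>) / (r^2 * r)"
    unfolding dc using r(1) by (simp add: field_simps power2_eq_square)
  moreover have "(y \<phi> - 2*m) * r^2 + (d * sin \<phi>)^2 * y \<phi> = 2*m*(y \<phi>)^2 + (B + d^2 - 4*m^2) * y \<phi> - 2*m*B"
    unfolding ds r(2) by algebra
  ultimately show ?th1 unfolding r(2) by (simp add: r_def)
  have "((\<lambda>\<phi>. d * sin \<phi> * y \<phi> / sqrt ((y \<phi>)^2 + B)) has_real_derivative
     ((d * cos \<phi> * y \<phi> - (d * sin \<phi>)^2) * r - d * sin \<phi> * y \<phi> * (y \<phi> * (- (d * sin \<phi>)) / r)) / (r * r)) (at \<phi>)"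
  proof -
    have "((\<lambda>\<phi>. d * sin \<phi> * y \<phi>) has_real_derivative d * cos \<phi> * y \<phi> - (d * sin \<phi>)^2) (at \<phi>)"
      by (rule derivative_eq_intros dy refl)+ (simp add: power2_eq_square)
    from DERIV_divide[OF this dr] r(1) show ?thesis by (simp add: r_def)
  qed
  moreover have "((d * cos \<phi> * y \<phi> - (d * sin \<phi>)^2) * r - d * sin \<phi> * y \<phi> * (y \<phi> * (- (d * sin \<phi>)) / r)) / (r * r)
     = (((y \<phi> - 2*m) * y \<phi> - (d * sin \<phi>)^2) * r^2 + (d * sin \<phi>)^2 * (y \<phi>)^2) / (r^2 * r)"
    unfolding dc using r(1) by (simp add: field_simps power2_eq_square)
  moreover have "((y \<phi> - 2*m) * y \<phi> - (d * sin \<phi>)^2) * r^2 + (d * sin \<phi>)^2 * (y \<phi>)^2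
     = (y \<phi>)^4 - 2*m*(y \<phi>)^3 + 2*B*(y \<phi>)^2 - 6*m*B*y \<phi> + B*(4*m^2 - d^2)"
    unfolding ds r(2) by algebra
  ultimately show ?th2 unfolding r(2) by (simp add: r_def)
qed

text \<open>Adding the second exact form of \<open>closure_exact_form\<close> leaves a numerator
  whose sign is controlled by \<open>B\<close> and \<open>k\<close>.\<close>

lemma closure_integral_by_parts:
  fixes m d B k :: real
  assumes q: "\<And>\<phi>. 0 < (2*m + d * cos \<phi>)^2 + B"
  shows "closure_integral m d B k = integral {0..2*pi} (\<lambda>\<phi>. (k * ((2*m + d * cos \<phi>)^2 + B) - B * (d * sin \<phi>)^2) /
      (((2*m + d * cos \<phi>)^2 + B) * sqrt ((2*m + d * cos \<phi>)^2 + B)))"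
  unfolding closure_integral_def
proof (rule integral_eq_of_exact_difference)
  let ?y = "\<lambda>\<phi>. 2*m + d * cos \<phi>"
  let ?h = "\<lambda>\<phi>. - (d * sin \<phi> * ?y \<phi> / sqrt ((?y \<phi>)^2 + B))"
  let ?h' = "\<lambda>\<phi>. - (((?y \<phi>)^4 - 2*m*(?y \<phi>)^3 + 2*B*(?y \<phi>)^2 - 6*m*B*?y \<phi> + B*(4*m^2 - d^2)) / (((?y \<phi>)^2 + B) * sqrt ((?y \<phi>)^2 + B)))"
  show "(?h has_real_derivative ?h' \<phi>) (at \<phi>)" for \<phi>
    by (intro DERIV_minus closure_exact_form q)
  show "?h 0 = ?h (2*pi)" by simp
  show "continuous_on {0..2*pi} (\<lambda>\<phi>. (k * ((2*m + d * cos \<phi>)^2 + B) - B * (d * sin \<phi>)^2) /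
      (((2*m + d * cos \<phi>)^2 + B) * sqrt ((2*m + d * cos \<phi>)^2 + B)))"
    using q by (intro continuous_intros) (auto simp: less_imp_neq[symmetric] dest: less_imp_neq)
  show "(k + 2*m*?y \<phi> - (?y \<phi>)^2) / sqrt ((?y \<phi>)^2 + B) = (k * ((?y \<phi>)^2 + B) - B * (d * sin \<phi>)^2) /
      (((?y \<phi>)^2 + B) * sqrt ((?y \<phi>)^2 + B)) + ?h' \<phi>" for \<phi>
  proof -
    define y where "y = ?y \<phi>"
    define r where "r = sqrt (y^2 + B)"
    have r: "0 < r" "r^2 = y^2 + B" using q[of \<phi>] by (simp_all add: r_def y_def)
    have ds: "(d * sin \<phi>)^2 = d^2 - (y - 2*m)^2"
      by (simp add: y_def power_mult_distrib sin_squared_eq algebra_simps)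
    have "(k + 2*m*y - y^2) * (y^2+B) = k * (y^2 + B) - B * (d^2 - (y - 2*m)^2)
        - (y^4 - 2*m*y^3 + 2*B*y^2 - 6*m*B*y + B*(4*m^2 - d^2))" by algebra
    then have "(k + 2*m*y - y^2) / r = (k * (y^2 + B) - B * (d^2 - (y - 2*m)^2)
        - (y^4 - 2*m*y^3 + 2*B*y^2 - 6*m*B*y + B*(4*m^2 - d^2))) / ((y^2+B) * r)"
      using r by (metis mult.commute mult_divide_mult_cancel_left power_not_zero less_numeral_extra(3))
    then show ?thesis
      unfolding y_def[symmetric] ds r_def[symmetric] by (simp add: diff_divide_distrib)
  qed
qed

text \<open>After integration by parts the numerator \<open>?N\<close> can neither be positive
  throughout, nor be nonpositive throughout with a negative value somewhere. The former would happen
  for \<open>B \<le> 0\<close>, the latter for \<open>k \<le> 0\<close>. The last bound says that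
  \<open>?N\<close>, a quadratic in \<open>y\<close>, has nonnegative discriminant.\<close>

lemma closure_integral_zero_imp:
  fixes m d B k :: real
  assumes q: "\<And>\<phi>. 0 < (2*m + d * cos \<phi>)^2 + B" and d: "0 < d" and k: "2*k = 4 + d^2 - B"
    and zero: "closure_integral m d B k = 0"
  shows "0 < B" "0 < k" "(k + B) * (k - d^2 + 4*m^2) \<le> 4*m^2*B"
proof -
  let ?y = "\<lambda>\<phi>. 2*m + d * cos \<phi>"
  let ?N = "\<lambda>\<phi>. k * ((?y \<phi>)^2 + B) - B * (d * sin \<phi>)^2"
  let ?w = "\<lambda>\<phi>. ((?y \<phi>)^2 + B) * sqrt ((?y \<phi>)^2 + B)"
  have w: "0 < ?w \<phi>" for \<phi> using q[of \<phi>] by simp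
  have cont: "continuous_on {0..2*pi} (\<lambda>\<phi>. ?N \<phi> / ?w \<phi>)"
    using q by (intro continuous_intros) (auto simp: less_imp_neq[symmetric] dest: less_imp_neq)
  have zero': "integral {0..2*pi} (\<lambda>\<phi>. ?N \<phi> / ?w \<phi>) = 0"
    using zero closure_integral_by_parts[OF q] by simp
  have halfpi: "pi/2 \<in> {0..2*pi}" by auto
  have notpos: "\<not> (\<forall>\<phi>. 0 < ?N \<phi>)"
  proof
    assume N: "\<forall>\<phi>. 0 < ?N \<phi>"
    have "0 < integral {0..2*pi} (\<lambda>\<phi>. ?N \<phi> / ?w \<phi>)"
    proof (rule integral_pos_of_continuous[OF cont _ _ halfpi])
      show "0 \<le> ?N \<phi> / ?w \<phi>" for \<phi> using N w by (meson divide_pos_pos less_imp_le)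
      show "?N (pi/2) / ?w (pi/2) \<noteq> 0" using N w by (metis divide_pos_pos less_irrefl)
    qed simp
    then show False using zero' by simp
  qed
  show B: "0 < B"
  proof (rule ccontr)
    assume "\<not> 0 < B"
    then have "B \<le> 0" by simp
    have "0 < k" using k d \<open>B \<le> 0\<close> by (smt (verit) zero_less_power)
    have "0 < ?N \<phi>" for \<phi>
      using mult_pos_pos[OF \<open>0 < k\<close> q[of \<phi>]] mult_nonpos_nonneg[OF \<open>B \<le> 0\<close> zero_le_power2[of "d * sin \<phi>"]] by linarith
    then show False using notpos by blast
  qed
  show k0: "0 < k"
  proof (rule ccontr)
    assume "\<not> 0 < k"
    then have "k \<le> 0" by simp
    have N: "?N \<phi> \<le> - (B * (d * sin \<phi>)^2)" for \<phi>
      using mult_nonpos_nonneg[OF \<open>k \<le> 0\<close> less_imp_le[OF q[of \<phi>]]] by linarith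
    have N0: "?N \<phi> \<le> 0" for \<phi> using N[of \<phi>] B by (smt (verit) mult_nonneg_nonneg zero_le_power2)
    have "?N (pi/2) < 0" using N[of "pi/2"] B d by (smt (verit) mult_pos_pos sin_pi_half zero_less_power mult.right_neutral)
    then have "?N (pi/2) / ?w (pi/2) \<noteq> 0" using w[of "pi/2"] by (metis divide_neg_pos less_irrefl)
    moreover have "0 \<le> - (?N \<phi> / ?w \<phi>)" for \<phi>
      using N0[of \<phi>] w[of \<phi>] by (simp add: divide_nonpos_pos)
    ultimately have "0 < integral {0..2*pi} (\<lambda>\<phi>. - (?N \<phi> / ?w \<phi>))"
      by (intro integral_pos_of_continuous[OF continuous_on_minus[OF cont] _ _ halfpi]) (simp, blast, metis neg_equal_0_iff_equal)
    then show False using zero' by simp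
  qed
  show "(k + B) * (k - d^2 + 4*m^2) \<le> 4*m^2*B"
  proof (rule ccontr)
    assume "\<not> ?thesis"
    then have dis: "4*m^2*B < (k + B) * (k - d^2 + 4*m^2)" by simp
    have "0 < ?N \<phi>" for \<phi>
    proof -
      have ds: "(d * sin \<phi>)^2 = d^2 - (?y \<phi> - 2*m)^2"
        by (simp add: power_mult_distrib sin_squared_eq algebra_simps)
      \<comment> \<open>Completing the square in \<open>y\<close>, after multiplying by the leading
        coefficient \<open>k + B\<close>.\<close>
      have "(k + B) * ?N \<phi> = ((k + B) * ?y \<phi> - 2*m*B)^2 + B * ((k + B) * (k - d^2 + 4*m^2) - 4*m^2*B)"
        unfolding ds by algebra
      moreover have "0 < B * ((k + B) * (k - d^2 + 4*m^2) - 4*m^2*B)" using B dis by simp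
      ultimately have "0 < (k + B) * ?N \<phi>" by (simp add: add_nonneg_pos)
      then show ?thesis using B k0 by (smt (verit) zero_less_mult_pos)
    qed
    then show False using notpos by blast
  qed
qed

section \<open>The closure integral along a family of fixed energy\<close>

text \<open>The two bracketed polynomials on the right are the exact forms of \<open>closure_exact_form\<close>; the
  linear system for \<open>\<beta>\<close> and \<open>g\<close> removes everything else from the double poles.\<close>

lemma closure_derivative_identity:
  fixes m B k h \<epsilon> D k' \<beta> g :: real
  defines "W \<equiv> B + D - 4*m^2"
  defines "b \<equiv> 4*m^2 - h*B - h*k + \<epsilon>*(k-D)" and "r \<equiv> 2*B + 2*h*B + 2*k - 2*k*\<epsilon>"
  assumes 1: "4*B*\<beta> - W*g = r" and 2: "W*\<beta> + 4*m^2*g = - b"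
    and \<alpha>: "\<alpha> = k' + h*B - k*\<epsilon> - \<beta>*(k+B) - 2*m^2*g"
  shows "(k' + 2*m*y + 2*m*(2*m+\<epsilon>*(y-2*m)) - 2*y*(2*m+\<epsilon>*(y-2*m))) * (y^2+B)
      - (k+2*m*y-y^2) * (y*(2*m+\<epsilon>*(y-2*m)) + h*B)
    = (\<alpha> + \<beta> * (k+2*m*y-y^2)) * (y^2+B)
      + (m*g*(2*m*y^2 + (B + D - 4*m^2) * y - 2*m*B)
        + (\<beta>-\<epsilon>)*(y^4 - 2*m*y^3 + 2*B*y^2 - 6*m*B*y + B*(4*m^2 - D)))"
    (is "?l = ?r")
proof -
  \<comment> \<open>Terms of higher degree in \<open>y\<close> cancel by themselves; only the
    residuals of the two linear equations remain.\<close>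
  have "?l - ?r = m*y*(4*B*\<beta> - W*g - r) + B*(W*\<beta> + 4*m^2*g + b)"
    unfolding \<alpha> W_def b_def r_def by algebra
  then show ?thesis using 1 2 by simp
qed


text \<open>The parameters \<open>m = \<rho>/\<sigma>\<close>, \<open>D\<close>, \<open>B\<close>, \<open>k\<close> solve the coefficient equations
  \<open>m (D + B) = 4 \<rho>\<close>, \<open>D + 2 m\<^sup>2 - B = 4 (K - 1)\<close>, \<open>(D - m\<^sup>2) (m\<^sup>2 + B) = 4 (H - \<rho>\<^sup>2 - K\<^sup>2)\<close> of the
  factored quartic, with \<open>\<sigma> = (D + B)/4\<close> and \<open>k = 2 K - m\<^sup>2\<close>.\<close>

locale closure_path =
  fixes \<rho> H :: real
  assumes H: "0 < H"
begin

definition n where "n \<sigma> = (\<rho>/\<sigma>)^2"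
text \<open>Inserting \<open>\<rho> = m * \<sigma>\<close> and \<open>K = (k + m^2)/2\<close> into
  the third coefficient equation gives \<open>H = (1+n) * (k - 1 + \<sigma>^2)\<close>. Then
  \<open>B\<close> and \<open>D\<close> come from \<open>D + B = 4*\<sigma>\<close> and
  \<open>D - B = 2*k - 4\<close>.\<close>

definition k where "k \<sigma> = 1 + H/(1 + n \<sigma>) - \<sigma>^2"
definition B where "B \<sigma> = 2*(\<sigma>+1) - k \<sigma>"
definition D where "D \<sigma> = 2*(\<sigma>-1) + k \<sigma>"
text \<open>The conclusions of \<open>closure_integral_zero_imp\<close> in these parameters: the
  last term is a quarter of the slack in the discriminant bound, and for positive \<sigma> and
  \<open>k\<close> it yields \<open>1 \<le> \<sigma>\<close>.\<close>

definition admissible where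
  "admissible \<sigma> \<longleftrightarrow> 1 \<le> \<sigma> \<and> 0 < k \<sigma> \<and> 0 < B \<sigma> \<and> 0 \<le> \<sigma>^2 - 1 - n \<sigma> * k \<sigma>"
text \<open>\<open>\<tau>\<close> equals \<open>n*H/(1+n)^2\<close>, and \<open>- 2*\<tau>\<close>
  is the part of the change of \<open>k\<close> along - \<sigma> d/d\<sigma> that comes from
  \<open>n\<close>. Below, \<open>h\<close> and \<open>\<epsilon>\<close> are the logarithmic
  derivatives of the square roots of \<open>B\<close> and \<open>D\<close> in that
  direction.\<close>

definition \<tau> where "\<tau> \<sigma> = n \<sigma> * (\<sigma>^2 - 1 + k \<sigma>) / (1 + n \<sigma>)"
definition h where "h \<sigma> = (\<tau> \<sigma> - \<sigma> - \<sigma>^2) / B \<sigma>"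
definition \<epsilon> where "\<epsilon> \<sigma> = (\<sigma>^2 - \<sigma> - \<tau> \<sigma>) / D \<sigma>"
definition I where "I \<sigma> = closure_integral (\<rho>/\<sigma>) (sqrt (D \<sigma>)) (B \<sigma>) (k \<sigma>)"

lemma n_nonneg: "0 \<le> n \<sigma>" by (simp add: n_def)
lemma n1: "0 < 1 + n \<sigma>" using n_nonneg[of \<sigma>] by simp

lemma D_pos: "admissible \<sigma> \<Longrightarrow> 0 < D \<sigma>" by (simp add: admissible_def D_def)

lemma k_derivative:
  assumes "\<sigma> \<noteq> 0"
  shows "(k has_real_derivative - (2 * (\<sigma>^2 - \<tau> \<sigma>)) / \<sigma>) (at \<sigma>)"
proof -
  have "((\<lambda>\<sigma>. (\<rho>/\<sigma>)^2) has_real_derivative 2 * (\<rho>/\<sigma>) * (- \<rho> / \<sigma>^2)) (at \<sigma>)"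
    using assms by (auto intro!: derivative_eq_intros simp: power2_eq_square)
  then have dn: "(n has_real_derivative - (2 * n \<sigma>) / \<sigma>) (at \<sigma>)"
    unfolding n_def by (simp add: power2_eq_square mult.assoc)
  have "(k has_real_derivative - (H * (- (2 * n \<sigma>) / \<sigma>)) / ((1 + n \<sigma>) * (1 + n \<sigma>)) - 2 * \<sigma>) (at \<sigma>)"
    unfolding k_def using n1[of \<sigma>] by (auto intro!: derivative_eq_intros dn)
  moreover have "\<tau> \<sigma> = n \<sigma> * H / ((1 + n \<sigma>) * (1 + n \<sigma>))" by (simp add: \<tau>_def k_def)
  then have "- (H * (- (2 * n \<sigma>) / \<sigma>)) / ((1 + n \<sigma>) * (1 + n \<sigma>)) - 2 * \<sigma> = - (2 * (\<sigma>^2 - \<tau> \<sigma>)) / \<sigma>"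
    using assms by (simp add: power2_eq_square diff_divide_distrib right_diff_distrib mult.commute)
  ultimately show ?thesis by simp
qed

text \<open>In this form the discriminant condition also controls the derivative of
  \<open>k\<close>, as it forces \<open>\<sigma>^2 - \<tau> \<sigma>\<close> to be at least
  1.\<close>

lemma \<tau>_bound_iff: "0 \<le> \<sigma>^2 - 1 - n \<sigma> * k \<sigma> \<longleftrightarrow> \<tau> \<sigma> \<le> \<sigma>^2 - 1"
proof -
  have "\<sigma>^2 - 1 - n \<sigma> * k \<sigma> = (\<sigma>^2 - 1 - \<tau> \<sigma>) * (1 + n \<sigma>)"
    using n1[of \<sigma>] by (simp add: \<tau>_def field_simps)
  then show ?thesis using n1[of \<sigma>] by (simp add: zero_le_mult_iff)
qed

text \<open>Makes visible that \<open>\<tau> \<sigma> / \<sigma>^2\<close> does not increase for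
  positive \<sigma>.\<close>

lemma \<tau>_eq: "\<sigma> \<noteq> 0 \<Longrightarrow> \<tau> \<sigma> = \<sigma>^2 * (H * \<rho>^2 / (\<sigma>^2 + \<rho>^2)^2)"
proof -
  assume \<sigma>: "\<sigma> \<noteq> 0"
  have "\<tau> \<sigma> = n \<sigma> * H / (1 + n \<sigma>)^2" by (simp add: \<tau>_def k_def power2_eq_square)
  also have "n \<sigma> = \<rho>^2 / \<sigma>^2" by (simp add: n_def power_divide)
  also have "1 + \<rho>^2 / \<sigma>^2 = (\<sigma>^2 + \<rho>^2) / \<sigma>^2" using \<sigma> by (simp add: add_divide_distrib)
  finally show ?thesis using \<sigma> by (simp add: power2_eq_square field_simps)
qed

text \<open>From \<open>a\<close> onwards \<open>\<tau> x \<le> x^2 - 1\<close> persists, since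
  \<open>\<tau> x / x^2\<close> does not increase and \<open>(x^2 - 1) / x^2\<close> does not
  decrease. Hence \<open>k\<close> is nonincreasing and \<open>B\<close> nondecreasing, so
  \<open>k\<close> inherits positivity from \<open>b\<close> and \<open>B\<close> from
  \<open>a\<close>.\<close>

lemma admissible_between:
  assumes "admissible a" "admissible b" "x \<in> {a..b}"
  shows "admissible x"
proof -
  have a1: "1 \<le> a" using assms(1) by (simp add: admissible_def)
  have \<tau>: "\<tau> x \<le> x^2 - 1" if "a \<le> x" for x
  proof -
    have x: "1 \<le> x" using a1 that by simp
    have sq: "a^2 \<le> x^2" using that a1 by (simp add: power_mono)
    have "H * \<rho>^2 / (x^2 + \<rho>^2)^2 \<le> H * \<rho>^2 / (a^2 + \<rho>^2)^2"
      using sq a1 x H by (intro divide_left_mono power_mono mult_pos_pos zero_less_power add_pos_nonneg) auto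
    also have "\<dots> = \<tau> a / a^2" using a1 by (simp add: \<tau>_eq)
    also have "\<dots> \<le> (a^2 - 1) / a^2"
      using assms(1) \<tau>_bound_iff[of a] by (intro divide_right_mono) (auto simp: admissible_def)
    also have "\<dots> \<le> (x^2 - 1) / x^2"
      using sq a1 x by (simp add: diff_divide_distrib frac_le)
    finally show ?thesis using x by (simp add: \<tau>_eq field_simps)
  qed
  have mono: "k y \<le> k x" if "a \<le> x" "x \<le> y" for x y
  proof (rule DERIV_nonpos_imp_nonincreasing[OF that(2)])
    fix z assume "x \<le> z" "z \<le> y"
    then have z: "a \<le> z" using that by simp
    then have "- (2 * (z^2 - \<tau> z)) / z \<le> 0" using \<tau>[OF z] a1 by (auto simp: divide_nonpos_pos)
    then show "\<exists>d. (k has_real_derivative d) (at z) \<and> d \<le> 0"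
      using k_derivative[of z] z a1 by auto
  qed
  show ?thesis
    using assms mono[of a x] mono[of x b] \<tau>[of x] \<tau>_bound_iff[of x]
    by (auto simp: admissible_def B_def)
qed


text \<open>The numerator of \<open>integrand'\<close> is written with derivatives along \<open>- \<sigma> d/d\<sigma>\<close>, under which \<open>m\<close>, \<open>D\<close>, \<open>B\<close>, \<open>k\<close> change by
  \<open>m\<close>, \<open>2 \<epsilon> D\<close>, \<open>2 h B\<close>, \<open>2 (\<sigma>\<^sup>2 - \<tau>)\<close>.\<close>

definition integrand where
  "integrand \<sigma> \<phi> = (let m = \<rho>/\<sigma>; y = 2*m + sqrt (D \<sigma>) * cos \<phi>
     in (k \<sigma> + 2*m*y - y^2) / sqrt (y^2 + B \<sigma>))"

definition integrand' where
  "integrand' \<sigma> \<phi> = (let m = \<rho>/\<sigma>; y = 2*m + sqrt (D \<sigma>) * cos \<phi>; y' = 2*m + \<epsilon> \<sigma> * (y - 2*m)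
     in - ((2*(\<sigma>^2 - \<tau> \<sigma>) + 2*m*y + 2*m*y' - 2*y*y') * (y^2 + B \<sigma>)
       - (k \<sigma> + 2*m*y - y^2) * (y*y' + h \<sigma> * B \<sigma>)) / (\<sigma> * ((y^2 + B \<sigma>) * sqrt (y^2 + B \<sigma>))))"

lemma integrand_derivative:
  assumes "admissible \<sigma>"
  shows "((\<lambda>\<sigma>. integrand \<sigma> \<phi>) has_real_derivative integrand' \<sigma> \<phi>) (at \<sigma>)"
proof -
  have \<sigma>: "0 < \<sigma>" and B: "0 < B \<sigma>" and D: "0 < D \<sigma>"
    using assms D_pos[OF assms] by (auto simp: admissible_def)
  define m where "m = \<rho>/\<sigma>"
  define Y where "Y = (\<lambda>\<sigma>. 2*(\<rho>/\<sigma>) + sqrt (D \<sigma>) * cos \<phi>)"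
  define y' where "y' = 2*m + \<epsilon> \<sigma> * (Y \<sigma> - 2*m)"
  define r where "r = sqrt ((Y \<sigma>)^2 + B \<sigma>)"
  have q: "0 < (Y \<sigma>)^2 + B \<sigma>" using B by (simp add: add_nonneg_pos)
  then have r: "0 < r" "r^2 = (Y \<sigma>)^2 + B \<sigma>" by (auto simp: r_def)
  have dk: "(k has_real_derivative - (2 * (\<sigma>^2 - \<tau> \<sigma>)) / \<sigma>) (at \<sigma>)"
    using \<sigma> by (intro k_derivative) simp
  have dm: "((\<lambda>\<sigma>. \<rho>/\<sigma>) has_real_derivative - m / \<sigma>) (at \<sigma>)"
    using \<sigma> by (auto intro!: derivative_eq_intros simp: m_def)
  have "(B has_real_derivative 2 + (2 * (\<sigma>^2 - \<tau> \<sigma>)) / \<sigma>) (at \<sigma>)"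
    unfolding B_def by (rule derivative_eq_intros dk refl)+ (use \<sigma> in \<open>simp add: field_simps\<close>)
  moreover have hB: "h \<sigma> * B \<sigma> = \<tau> \<sigma> - \<sigma> - \<sigma>^2" using B by (simp add: h_def)
  have "2 + (2 * (\<sigma>^2 - \<tau> \<sigma>)) / \<sigma> = - (2 * (h \<sigma> * B \<sigma>)) / \<sigma>"
    unfolding hB using \<sigma> by (simp add: field_simps power2_eq_square)
  ultimately have dB: "(B has_real_derivative - (2 * (h \<sigma> * B \<sigma>)) / \<sigma>) (at \<sigma>)" by simp
  have "(D has_real_derivative 2 - (2 * (\<sigma>^2 - \<tau> \<sigma>)) / \<sigma>) (at \<sigma>)"
    unfolding D_def by (rule derivative_eq_intros dk refl)+ (use \<sigma> in \<open>simp add: field_simps\<close>)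
  moreover have \<epsilon>D: "\<epsilon> \<sigma> * D \<sigma> = \<sigma>^2 - \<sigma> - \<tau> \<sigma>" using D by (simp add: \<epsilon>_def)
  have "2 - (2 * (\<sigma>^2 - \<tau> \<sigma>)) / \<sigma> = - (2 * (\<epsilon> \<sigma> * D \<sigma>)) / \<sigma>"
    unfolding \<epsilon>D using \<sigma> by (simp add: field_simps power2_eq_square)
  ultimately have dD: "(D has_real_derivative - (2 * (\<epsilon> \<sigma> * D \<sigma>)) / \<sigma>) (at \<sigma>)" by simp
  have "((\<lambda>\<sigma>. sqrt (D \<sigma>)) has_real_derivative inverse (sqrt (D \<sigma>)) / 2 * (- (2 * (\<epsilon> \<sigma> * D \<sigma>)) / \<sigma>)) (at \<sigma>)"
    by (rule DERIV_chain2[OF DERIV_real_sqrt[OF D] dD])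
  moreover have "inverse s / 2 * (- (2 * (e * (s * s))) / \<sigma>) = - (e * s) / \<sigma>" if "0 < s" for s e
    using that \<sigma> by (simp add: field_simps)
  from this[of "sqrt (D \<sigma>)" "\<epsilon> \<sigma>"]
  have "inverse (sqrt (D \<sigma>)) / 2 * (- (2 * (\<epsilon> \<sigma> * D \<sigma>)) / \<sigma>) = - (\<epsilon> \<sigma> * sqrt (D \<sigma>)) / \<sigma>"
    using D by simp
  ultimately have dd: "((\<lambda>\<sigma>. sqrt (D \<sigma>)) has_real_derivative - (\<epsilon> \<sigma> * sqrt (D \<sigma>)) / \<sigma>) (at \<sigma>)" by (simp only:)
  have "(Y has_real_derivative 2 * (- m / \<sigma>) + - (\<epsilon> \<sigma> * sqrt (D \<sigma>)) / \<sigma> * cos \<phi>) (at \<sigma>)"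
    unfolding Y_def by (intro DERIV_add DERIV_cmult DERIV_cmult_right dm dd)
  moreover have "2 * (- m / \<sigma>) + - (\<epsilon> \<sigma> * sqrt (D \<sigma>)) / \<sigma> * cos \<phi> = - y' / \<sigma>"
    using \<sigma> by (simp add: y'_def Y_def m_def field_simps)
  ultimately have dY: "(Y has_real_derivative - y' / \<sigma>) (at \<sigma>)" by simp
  have dN: "((\<lambda>\<sigma>. k \<sigma> + 2*(\<rho>/\<sigma>)*Y \<sigma> - (Y \<sigma>)^2) has_real_derivative
      - (2*(\<sigma>^2 - \<tau> \<sigma>) + 2*m*Y \<sigma> + 2*m*y' - 2*Y \<sigma>*y') / \<sigma>) (at \<sigma>)"
    by (rule derivative_eq_intros dk dm dY refl)+ (use \<sigma> in \<open>simp add: m_def field_simps\<close>)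
  have "((\<lambda>\<sigma>. (Y \<sigma>)^2 + B \<sigma>) has_real_derivative - (2 * (Y \<sigma>*y' + h \<sigma> * B \<sigma>)) / \<sigma>) (at \<sigma>)"
    by (rule derivative_eq_intros dB dY refl)+ (use \<sigma> in \<open>simp add: field_simps\<close>)
  from DERIV_chain2[OF DERIV_real_sqrt[OF q] this]
  have "((\<lambda>\<sigma>. sqrt ((Y \<sigma>)^2 + B \<sigma>)) has_real_derivative inverse r / 2 * (- (2 * (Y \<sigma>*y' + h \<sigma> * B \<sigma>)) / \<sigma>)) (at \<sigma>)"
    by (simp add: r_def)
  moreover have "inverse r / 2 * (- (2 * Z) / \<sigma>) = - Z / (r * \<sigma>)" for Z
    using r(1) \<sigma> by (simp add: field_simps)
  ultimately have dr: "((\<lambda>\<sigma>. sqrt ((Y \<sigma>)^2 + B \<sigma>)) has_real_derivative - (Y \<sigma>*y' + h \<sigma> * B \<sigma>) / (r * \<sigma>)) (at \<sigma>)"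
    by (simp only:)
  have "((\<lambda>\<sigma>. (k \<sigma> + 2*(\<rho>/\<sigma>)*Y \<sigma> - (Y \<sigma>)^2) / sqrt ((Y \<sigma>)^2 + B \<sigma>)) has_real_derivative
     (- (2*(\<sigma>^2 - \<tau> \<sigma>) + 2*m*Y \<sigma> + 2*m*y' - 2*Y \<sigma>*y') / \<sigma> * r
       - (k \<sigma> + 2*m*Y \<sigma> - (Y \<sigma>)^2) * (- (Y \<sigma>*y' + h \<sigma> * B \<sigma>) / (r * \<sigma>))) / (r * r)) (at \<sigma>)"
    using DERIV_divide[OF dN dr] r(1) unfolding m_def r_def by simp
  moreover have "(- N / \<sigma> * r - M * (- Z / (r * \<sigma>))) / (r * r) = - (N * r^2 - M * Z) / (\<sigma> * (r^2 * r))" for N M Z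
    using \<sigma> r(1) by (simp add: field_simps power2_eq_square)
  ultimately have "((\<lambda>\<sigma>. (k \<sigma> + 2*(\<rho>/\<sigma>)*Y \<sigma> - (Y \<sigma>)^2) / sqrt ((Y \<sigma>)^2 + B \<sigma>)) has_real_derivative
     - ((2*(\<sigma>^2 - \<tau> \<sigma>) + 2*m*Y \<sigma> + 2*m*y' - 2*Y \<sigma>*y') * r^2
       - (k \<sigma> + 2*m*Y \<sigma> - (Y \<sigma>)^2) * (Y \<sigma>*y' + h \<sigma> * B \<sigma>)) / (\<sigma> * (r^2 * r))) (at \<sigma>)" by (simp only:)
  then show ?thesis
    unfolding r(2) unfolding r_def
    by (simp add: integrand_def integrand'_def Let_def y'_def Y_def m_def)
qed


section \<open>Differentiation under the integral sign and the crossing argument\<close>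

lemma I_eq: "I \<sigma> = integral {0..2*pi} (integrand \<sigma>)"
  by (simp add: I_def closure_integral_def integrand_def[abs_def] Let_def)

text \<open>Leibniz rule; the work is joint continuity of \<open>integrand'\<close> on the
  rectangle, where positivity of \<open>B\<close> keeps the denominator from vanishing.\<close>

lemma I_derivative:
  assumes adm: "\<And>x. x \<in> {a..b} \<Longrightarrow> admissible x" and x: "x \<in> {a..b}"
  shows "(I has_real_derivative integral {0..2*pi} (integrand' x)) (at x within {a..b})"
proof -
  have pos: "0 < x" "0 < B x" "0 < D x" if "x \<in> {a..b}" for x
    using adm[OF that] D_pos[OF adm[OF that]] by (auto simp: admissible_def)
  have n1': "1 + n x \<noteq> 0" for x using n1[of x] by simp
  have cn: "continuous_on {a..b} n" unfolding n_def using pos by (intro continuous_intros) fastforce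
  have ck: "continuous_on {a..b} k" unfolding k_def using n1' by (intro continuous_intros cn) auto
  have cB: "continuous_on {a..b} B" unfolding B_def by (intro continuous_intros ck)
  have cD: "continuous_on {a..b} D" unfolding D_def by (intro continuous_intros ck)
  have c\<tau>: "continuous_on {a..b} \<tau>" unfolding \<tau>_def using n1' by (intro continuous_intros cn ck) auto
  have ch: "continuous_on {a..b} h" unfolding h_def using pos by (intro continuous_intros cB c\<tau>) fastforce
  have c\<epsilon>: "continuous_on {a..b} \<epsilon>" unfolding \<epsilon>_def using pos by (intro continuous_intros cD c\<tau>) fastforce
  have fst: "continuous_on ({a..b} \<times> cbox 0 (2*pi)) (\<lambda>z. f (fst z))" if "continuous_on {a..b} f" for f :: "real \<Rightarrow> real"
    by (rule continuous_on_compose2[OF that continuous_on_fst[OF continuous_on_id]]) auto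
  have nz: "(2 * (\<rho> / x) + sqrt (D x) * cos \<phi>)^2 + B x \<noteq> 0" if "x \<in> {a..b}" for x \<phi>
    using pos[OF that] by (metis add_nonneg_pos less_irrefl zero_le_power2)
  have cm: "continuous_on {a..b} (\<lambda>x. \<rho> / x)" using pos by (intro continuous_intros) fastforce
  define Y where "Y z = 2 * (\<rho> / fst z) + sqrt (D (fst z)) * cos (snd z)" for z :: "real \<times> real"
  have cY: "continuous_on ({a..b} \<times> cbox 0 (2*pi)) Y"
    unfolding Y_def by (intro continuous_intros fst[OF cD] fst[OF cm])
  have split: "integrand' x \<phi> = - ((2*(x^2 - \<tau> x) + 2*(\<rho>/x)*y + 2*(\<rho>/x)*y' - 2*y*y') * q
      - (k x + 2*(\<rho>/x)*y - y^2) * (y*y' + h x * B x)) / (x * (q * sqrt q))"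
    if "y = Y (x, \<phi>)" "y' = 2*(\<rho>/x) + \<epsilon> x * (y - 2*(\<rho>/x))" "q = y^2 + B x" for x \<phi> y y' q
    unfolding that by (simp add: integrand'_def Let_def Y_def)
  define Y' where "Y' z = 2*(\<rho>/fst z) + \<epsilon> (fst z) * (Y z - 2*(\<rho>/fst z))" for z :: "real \<times> real"
  have cY': "continuous_on ({a..b} \<times> cbox 0 (2*pi)) Y'"
    unfolding Y'_def by (intro continuous_on_add continuous_on_mult continuous_on_diff continuous_on_const
        cY fst[OF c\<epsilon>] fst[OF cm])
  define q where "q z = (Y z)^2 + B (fst z)" for z :: "real \<times> real"
  have cq: "continuous_on ({a..b} \<times> cbox 0 (2*pi)) q"
    unfolding q_def by (intro continuous_on_add continuous_on_power cY fst[OF cB])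
  have c1: "continuous_on ({a..b} \<times> cbox 0 (2*pi)) (\<lambda>z. fst z * (q z * sqrt (q z)))"
    by (intro continuous_on_mult continuous_on_real_sqrt continuous_on_fst continuous_on_id cq)
  have c2: "continuous_on ({a..b} \<times> cbox 0 (2*pi)) (\<lambda>z. 2*((fst z)^2 - \<tau> (fst z)) + 2*(\<rho>/fst z)*Y z + 2*(\<rho>/fst z)*Y' z - 2*Y z*Y' z)"
    by (intro continuous_on_add continuous_on_mult continuous_on_diff continuous_on_const continuous_on_power
        continuous_on_fst[OF continuous_on_id] cY cY' fst[OF c\<tau>] fst[OF cm])
  have c3: "continuous_on ({a..b} \<times> cbox 0 (2*pi)) (\<lambda>z. (k (fst z) + 2*(\<rho>/fst z)*Y z - (Y z)^2) * (Y z*Y' z + h (fst z) * B (fst z)))"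
    by (intro continuous_on_add continuous_on_mult continuous_on_diff continuous_on_const continuous_on_power
        cY cY' fst[OF ck] fst[OF ch] fst[OF cB] fst[OF cm])
  have "fst z * (q z * sqrt (q z)) \<noteq> 0" if "z \<in> {a..b} \<times> cbox 0 (2*pi)" for z
    using nz[of "fst z" "snd z"] pos(1)[of "fst z"] that by (auto simp: Y_def q_def)
  then have "continuous_on ({a..b} \<times> cbox 0 (2*pi)) (\<lambda>z. - ((2*((fst z)^2 - \<tau> (fst z)) + 2*(\<rho>/fst z)*Y z + 2*(\<rho>/fst z)*Y' z - 2*Y z*Y' z) * q z
      - (k (fst z) + 2*(\<rho>/fst z)*Y z - (Y z)^2) * (Y z*Y' z + h (fst z) * B (fst z))) / (fst z * (q z * sqrt (q z))))"
    by (intro continuous_on_divide continuous_on_minus continuous_on_diff continuous_on_mult[OF c2 cq] c3 c1) blast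
  then have cont: "continuous_on ({a..b} \<times> cbox 0 (2*pi)) (\<lambda>(x, \<phi>). integrand' x \<phi>)"
    by (rule continuous_on_eq) (auto simp: split[OF refl refl refl] Y'_def q_def)
  have "((\<lambda>x. integral (cbox 0 (2*pi)) (integrand x)) has_real_derivative integral (cbox 0 (2*pi)) (integrand' x))
      (at x within {a..b})"
  proof (rule leibniz_rule_field_derivative[OF _ _ cont x])
    show "((\<lambda>x. integrand x t) has_real_derivative integrand' x t) (at x within {a..b})" if "x \<in> {a..b}" for x t
      using integrand_derivative[OF adm[OF that]] by (rule has_field_derivative_at_within)
    show "integrand x integrable_on cbox 0 (2*pi)" if "x \<in> {a..b}" for x
      unfolding integrand_def[abs_def] Let_def using nz[OF that]
      by (intro integrable_continuous continuous_intros) auto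
  qed auto
  then show ?thesis by (simp add: I_eq[abs_def])
qed

text \<open>At a zero of \<open>I\<close> the \<beta> term drops out, which leaves a negative
  multiple of the integral of \<open>1 / sqrt (q \<phi>)\<close>.\<close>

lemma I_downcrossing:
  assumes adm: "admissible \<sigma>" and zero: "I \<sigma> = 0"
  shows "integral {0..2*pi} (integrand' \<sigma>) < 0"
proof -
  have \<sigma>: "1 \<le> \<sigma>" and k0: "0 < k \<sigma>" and B: "0 < B \<sigma>" and z: "0 \<le> \<sigma>^2 - 1 - n \<sigma> * k \<sigma>"
    using adm by (auto simp: admissible_def)
  have D: "0 < D \<sigma>" using D_pos[OF adm] .
  define m where "m = \<rho>/\<sigma>"
  have nm: "n \<sigma> = m^2" by (simp add: n_def m_def)
  define d where "d = sqrt (D \<sigma>)"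
  have d2: "d^2 = D \<sigma>" using D by (simp add: d_def)
  define W where "W = B \<sigma> + D \<sigma> - 4*m^2"
  define b where "b = 4*m^2 - h \<sigma>*B \<sigma> - h \<sigma>*k \<sigma> + \<epsilon> \<sigma>*(k \<sigma>-D \<sigma>)"
  define r where "r = 2*B \<sigma> + 2*h \<sigma>*B \<sigma> + 2*k \<sigma> - 2*k \<sigma>*\<epsilon> \<sigma>"
  \<comment> \<open>Cramer's rule for the linear system of
    \<open>closure_derivative_identity\<close>; \<open>\<Delta>\<close> is its determinant.\<close>
  define \<Delta> where "\<Delta> = W^2 + 16*m^2*B \<sigma>"
  define \<beta> where "\<beta> = (4*m^2*r - W*b)/\<Delta>"
  define g where "g = (- 4*B \<sigma>*b - W*r)/\<Delta>"
  define \<alpha> where "\<alpha> = 2*(\<sigma>^2-\<tau> \<sigma>) + h \<sigma>*B \<sigma> - k \<sigma>*\<epsilon> \<sigma> - \<beta>*(k \<sigma>+B \<sigma>) - 2*m^2*g"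
  have W: "W = 4*\<sigma> - 4*m^2" by (simp add: W_def B_def D_def)
  have \<Delta>: "0 < \<Delta>"
  proof (cases "m = 0")
    case True then show ?thesis using \<sigma> by (simp add: \<Delta>_def W)
  next
    case False then show ?thesis using B by (simp add: \<Delta>_def add_nonneg_pos)
  qed
  have \<beta>\<Delta>: "\<beta> * \<Delta> = 4*m^2*r - W*b" and g\<Delta>: "g * \<Delta> = - 4*B \<sigma>*b - W*r"
    using \<Delta> by (simp_all add: \<beta>_def g_def)
  have "0 < \<alpha>"
    unfolding \<alpha>_def
    by (rule crossing_coefficient_pos[OF B_def D_def \<tau>_def h_def \<epsilon>_def W[folded nm] b_def[folded nm]
        r_def \<Delta> \<Delta>_def[folded nm] \<beta>\<Delta>[folded nm] g\<Delta> n_nonneg k0 \<sigma> z B, unfolded nm])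
  have rel1: "4*B \<sigma>*\<beta> - W*g = r"
  proof -
    have "(4*B \<sigma>*\<beta> - W*g) * \<Delta> = 4*B \<sigma>*(\<beta>*\<Delta>) - W*(g*\<Delta>)" by algebra
    also have "\<dots> = r * \<Delta>" unfolding \<beta>\<Delta> g\<Delta> by (simp add: \<Delta>_def algebra_simps power2_eq_square)
    finally show ?thesis using \<Delta> by simp
  qed
  have rel2: "W*\<beta> + 4*m^2*g = - b"
  proof -
    have "(W*\<beta> + 4*m^2*g) * \<Delta> = W*(\<beta>*\<Delta>) + 4*m^2*(g*\<Delta>)" by algebra
    also have "\<dots> = - b * \<Delta>" unfolding \<beta>\<Delta> g\<Delta> by (simp add: \<Delta>_def algebra_simps power2_eq_square)
    finally show ?thesis using \<Delta> mult_right_cancel[of \<Delta>] by blast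
  qed
  note identity = closure_derivative_identity[where k' = "2*(\<sigma>^2-\<tau> \<sigma>)",
      OF rel1[unfolded W_def r_def] rel2[unfolded W_def b_def] \<alpha>_def]
  define y where "y \<phi> = 2*m + d * cos \<phi>" for \<phi>
  define q where "q \<phi> = (y \<phi>)^2 + B \<sigma>" for \<phi>
  have q: "0 < q \<phi>" for \<phi> unfolding q_def using B by (simp add: add_nonneg_pos)
  define N where "N \<phi> = k \<sigma> + 2*m*y \<phi> - (y \<phi>)^2" for \<phi>
  define E0 where "E0 \<phi> = 2*m*(y \<phi>)^2 + (B \<sigma> + d^2 - 4*m^2) * y \<phi> - 2*m*B \<sigma>" for \<phi>
  define E1 where "E1 \<phi> = (y \<phi>)^4 - 2*m*(y \<phi>)^3 + 2*B \<sigma>*(y \<phi>)^2 - 6*m*B \<sigma>*y \<phi> + B \<sigma>*(4*m^2 - d^2)" for \<phi>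
  have cy: "continuous_on {0..2*pi} y" unfolding y_def by (intro continuous_intros)
  have cq: "continuous_on {0..2*pi} q" unfolding q_def by (intro continuous_intros cy)
  have cN: "continuous_on {0..2*pi} N" unfolding N_def by (intro continuous_intros cy)
  have q': "sqrt (q \<phi>) \<noteq> 0" for \<phi> using q[of \<phi>] by simp
  have cT: "continuous_on {0..2*pi} (\<lambda>\<phi>. 1 / sqrt (q \<phi>))"
    and cI: "continuous_on {0..2*pi} (\<lambda>\<phi>. N \<phi> / sqrt (q \<phi>))"
    using q' by (auto intro!: continuous_intros cq cN)
  have "integral {0..2*pi} (integrand' \<sigma>) = integral {0..2*pi} (\<lambda>\<phi>. (- \<alpha> / \<sigma>) * (1 / sqrt (q \<phi>)) + (- \<beta> / \<sigma>) * (N \<phi> / sqrt (q \<phi>)))"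
  proof (rule integral_eq_of_exact_difference)
    \<comment> \<open>The two functions of \<open>closure_exact_form\<close>, with the weights from
      \<open>closure_derivative_identity\<close> divided by \<open>- \<sigma>\<close>.\<close>
    let ?h = "\<lambda>\<phi>. (- (m*g) / \<sigma>) * (d * sin \<phi> / sqrt (q \<phi>)) + (- (\<beta> - \<epsilon> \<sigma>) / \<sigma>) * (d * sin \<phi> * y \<phi> / sqrt (q \<phi>))"
    let ?h' = "\<lambda>\<phi>. (- (m*g) / \<sigma>) * (E0 \<phi> / (q \<phi> * sqrt (q \<phi>))) + (- (\<beta> - \<epsilon> \<sigma>) / \<sigma>) * (E1 \<phi> / (q \<phi> * sqrt (q \<phi>)))"
    show "(?h has_real_derivative ?h' \<phi>) (at \<phi>)" for \<phi>
      using closure_exact_form[of m d \<phi> "B \<sigma>"] q[of \<phi>] unfolding q_def y_def E0_def E1_def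
      by (intro DERIV_add DERIV_cmult) auto
    show "?h 0 = ?h (2*pi)" by simp
    show "continuous_on {0..2*pi} (\<lambda>\<phi>. (- \<alpha> / \<sigma>) * (1 / sqrt (q \<phi>)) + (- \<beta> / \<sigma>) * (N \<phi> / sqrt (q \<phi>)))"
      by (intro continuous_on_add continuous_on_mult_left cT cI)
    show "integrand' \<sigma> \<phi> = (- \<alpha> / \<sigma>) * (1 / sqrt (q \<phi>)) + (- \<beta> / \<sigma>) * (N \<phi> / sqrt (q \<phi>)) + ?h' \<phi>" for \<phi>
    proof -
      have "integrand' \<sigma> \<phi> = - ((\<alpha> + \<beta> * N \<phi>) * q \<phi> + (m*g*E0 \<phi> + (\<beta> - \<epsilon> \<sigma>) * E1 \<phi>)) / (\<sigma> * (q \<phi> * sqrt (q \<phi>)))"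
      proof -
        have "integrand' \<sigma> \<phi> = - ((2*(\<sigma>^2-\<tau> \<sigma>) + 2*m*y \<phi> + 2*m*(2*m+\<epsilon> \<sigma>*(y \<phi>-2*m))
            - 2*y \<phi>*(2*m+\<epsilon> \<sigma>*(y \<phi>-2*m))) * ((y \<phi>)^2 + B \<sigma>)
          - (k \<sigma> + 2*m*y \<phi> - (y \<phi>)^2) * (y \<phi>*(2*m+\<epsilon> \<sigma>*(y \<phi>-2*m)) + h \<sigma>*B \<sigma>)) / (\<sigma> * (q \<phi> * sqrt (q \<phi>)))"
          by (simp only: integrand'_def Let_def m_def d_def y_def q_def)
        then show ?thesis unfolding identity by (simp only: q_def N_def E0_def E1_def d2 mult.assoc)
      qed
      also have "\<dots> = (- \<alpha> / \<sigma>) * (1 / sqrt (q \<phi>)) + (- \<beta> / \<sigma>) * (N \<phi> / sqrt (q \<phi>)) + ?h' \<phi>"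
      proof -
        have "- ((\<alpha> + \<beta> * M) * p + (X + Y)) / (\<sigma> * (p * s)) = (- \<alpha> / \<sigma>) * (1 / s) + (- \<beta> / \<sigma>) * (M / s)
            + (- (X / \<sigma>) * (1 / (p * s)) + - (Y / \<sigma>) * (1 / (p * s)))" if "0 < p" "0 < s" for M p s X Y
          using \<sigma> that by (simp add: field_simps)
        note eq = this
        define e where "e = \<beta> - \<epsilon> \<sigma>"
        show ?thesis
          unfolding e_def[symmetric] using eq[of "q \<phi>" "sqrt (q \<phi>)" "N \<phi>" "m*g*E0 \<phi>" "e * E1 \<phi>"] q[of \<phi>]
          by simp
      qed
      finally show ?thesis .
    qed
  qed
  also have "\<dots> = (- \<alpha> / \<sigma>) * integral {0..2*pi} (\<lambda>\<phi>. 1 / sqrt (q \<phi>)) + (- \<beta> / \<sigma>) * integral {0..2*pi} (\<lambda>\<phi>. N \<phi> / sqrt (q \<phi>))"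
    by (subst integral_add[OF integrable_continuous_real[OF continuous_on_mult_left[OF cT]]
          integrable_continuous_real[OF continuous_on_mult_left[OF cI]]])
       (simp only: integral_mult_right)
  also have "integral {0..2*pi} (\<lambda>\<phi>. N \<phi> / sqrt (q \<phi>)) = I \<sigma>"
    by (simp add: I_def closure_integral_def N_def q_def y_def m_def d_def)
  also have "(- \<alpha> / \<sigma>) * integral {0..2*pi} (\<lambda>\<phi>. 1 / sqrt (q \<phi>)) + (- \<beta> / \<sigma>) * I \<sigma> < 0"
  proof -
    have "0 < integral {0..2*pi} (\<lambda>\<phi>. 1 / sqrt (q \<phi>))"
      using q q' by (intro integral_pos_of_continuous[OF cT, of 0]) (auto simp: less_imp_le)
    then show ?thesis using \<open>0 < \<alpha>\<close> \<sigma> zero by (simp add: mult_neg_pos divide_neg_pos)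
  qed
  finally show ?thesis .
qed

lemma closure_unique:
  assumes "admissible a" "I a = 0" "admissible b" "I b = 0"
  shows "a = b"
proof -
  have False if "admissible a" "I a = 0" "admissible b" "I b = 0" "a < b" for a b
  proof -
    note adm = admissible_between[OF that(1,3)]
    show ?thesis
      by (rule no_two_zeros_of_downcrossing[OF I_derivative[OF adm] I_downcrossing[OF adm] that(5,2,4)])
  qed
  then show ?thesis using assms by (meson linorder_neqE)
qed

end

section \<open>Reduced orbits\<close>

text \<open>For horizontal field \<open>w\<^sub>1 = 1\<close>, \<open>w\<^sub>2 = 0\<close> and \<open>\<rho> = w\<^sub>3\<close>: \<open>s = u\<^sub>3 + \<rho>\<close>, \<open>p = u\<^sub>2\<close>,
  and \<open>X\<close> is the first coordinate, with velocity \<open>u\<^sub>1 = K - s\<^sup>2/2\<close>.\<close>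

definition reduced_orbit :: "real \<Rightarrow> real \<Rightarrow> real \<Rightarrow> (real \<Rightarrow> real) \<Rightarrow> (real \<Rightarrow> real) \<Rightarrow> (real \<Rightarrow> real) \<Rightarrow> bool" where
  "reduced_orbit \<rho> H K s p X \<longleftrightarrow>
     (\<forall>t. (s has_real_derivative p t) (at t)) \<and>
     (\<forall>t. (p has_real_derivative s t * (K - (s t)^2 / 2) - (s t - \<rho>)) (at t)) \<and>
     (\<forall>t. (X has_real_derivative K - (s t)^2 / 2) (at t)) \<and>
     (\<forall>t. (p t)^2 + (K - (s t)^2 / 2)^2 + (s t - \<rho>)^2 = H) \<and>
     (\<exists>C. \<forall>t. \<bar>X t\<bar> \<le> C) \<and> periodic s"

text \<open>The difference is \<open>a - b\<close> times
  \<open>K - 1 - (a^2 + a*b + b^2) / 2\<close>, which is bounded for bounded arguments.\<close>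

lemma cubic_lipschitz:
  fixes K \<rho> M :: real
  shows "\<exists>L. \<forall>a b. \<bar>a\<bar> \<le> M \<longrightarrow> \<bar>b\<bar> \<le> M \<longrightarrow>
    \<bar>(a * (K - a^2 / 2) - (a - \<rho>)) - (b * (K - b^2 / 2) - (b - \<rho>))\<bar> \<le> L * \<bar>a - b\<bar>"
proof (intro exI[of _ "\<bar>K - 1\<bar> + 3 * M^2 / 2"] allI impI)
  fix a b :: real assume ab: "\<bar>a\<bar> \<le> M" "\<bar>b\<bar> \<le> M"
  have "\<bar>a * b\<bar> \<le> M * M" "\<bar>a * a\<bar> \<le> M * M" "\<bar>b * b\<bar> \<le> M * M"
    unfolding abs_mult using ab by (intro mult_mono; simp)+
  moreover have "\<bar>(x + y + z) / 2\<bar> \<le> 3 * N / 2" if "\<bar>y\<bar> \<le> N" "\<bar>x\<bar> \<le> N" "\<bar>z\<bar> \<le> N" for x y z N :: real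
    using that by (simp add: abs_le_iff)
  ultimately have "\<bar>(a^2 + a*b + b^2) / 2\<bar> \<le> 3 * M^2 / 2"
    unfolding power2_eq_square by blast
  then have "\<bar>K - 1 - (a^2 + a*b + b^2) / 2\<bar> \<le> \<bar>K - 1\<bar> + 3 * M^2 / 2"
    using abs_triangle_ineq4[of "K - 1" "(a^2 + a*b + b^2) / 2"] by linarith
  then have "\<bar>a - b\<bar> * \<bar>K - 1 - (a^2 + a*b + b^2) / 2\<bar> \<le> \<bar>a - b\<bar> * (\<bar>K - 1\<bar> + 3 * M^2 / 2)"
    by (intro mult_left_mono) auto
  moreover have "(a * (K - a^2 / 2) - (a - \<rho>)) - (b * (K - b^2 / 2) - (b - \<rho>)) = (a - b) * (K - 1 - (a^2 + a*b + b^2) / 2)"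
    by (simp add: field_simps power2_eq_square)
  ultimately show "\<bar>(a * (K - a^2 / 2) - (a - \<rho>)) - (b * (K - b^2 / 2) - (b - \<rho>))\<bar> \<le> (\<bar>K - 1\<bar> + 3 * M^2 / 2) * \<bar>a - b\<bar>"
    by (simp add: abs_mult mult.commute)
qed

text \<open>The equations for \<open>s\<close> and \<open>p\<close> are autonomous and involve only
  \<rho> and \<open>K\<close>, so orbits sharing a phase point differ by a time shift.\<close>

lemma reduced_orbit_equal:
  assumes "reduced_orbit \<rho> H K s1 p1 X1" "reduced_orbit \<rho> H' K s2 p2 X2" "s1 t1 = s2 t2" "p1 t1 = p2 t2"
  shows "s2 (t2 + t) = s1 (t1 + t) \<and> p2 (t2 + t) = p1 (t1 + t)"
proof -
  have shift: "((\<lambda>t. f (c + t)) has_real_derivative f') (at t)" if "(f has_real_derivative f') (at (c + t))" for f f' and c t :: real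
    using that DERIV_shift[of f f' t c] by (simp add: add.commute)
  have s: "((\<lambda>t. s (c + t)) has_real_derivative 1 * p (c + t)) (at t)"
    and p: "((\<lambda>t. p (c + t)) has_real_derivative 1 * (s (c + t) * (K - (s (c + t))^2 / 2) - (s (c + t) - \<rho>))) (at t)"
    if "reduced_orbit \<rho> H K s p X" for H s p X c t
    using that unfolding reduced_orbit_def mult_1 by (blast intro: shift)+
  show ?thesis
    by (rule second_order_ode_unique[where \<theta> = "\<lambda>_. 1" and G = "\<lambda>x. x * (K - x^2 / 2) - (x - \<rho>)"
          and ?s1.0 = "\<lambda>t. s2 (t2 + t)" and ?s2.0 = "\<lambda>t. s1 (t1 + t)" and ?p1.0 = "\<lambda>t. p2 (t2 + t)"
          and ?p2.0 = "\<lambda>t. p1 (t1 + t)" and ?t0.0 = 0,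
          OF s[OF assms(2)] p[OF assms(2)] s[OF assms(1)] p[OF assms(1)] continuous_on_const cubic_lipschitz])
      (use assms in simp_all)
qed

lemma zero_of_bounded_constant_derivative:
  fixes X :: "real \<Rightarrow> real"
  assumes der: "\<And>t. (X has_real_derivative b) (at t)" and C: "\<And>t. \<bar>X t\<bar> \<le> C"
  shows "b = 0"
proof (rule ccontr)
  assume "b \<noteq> 0"
  have "((\<lambda>t. X t - b * t) has_real_derivative 0) (at t)" for t
    using DERIV_diff[OF der[of t] DERIV_cmult_Id[of b]] by simp
  from DERIV_isconst_all[OF allI[OF this], of _ 0] have X: "X t - b * t = X 0" for t by simp
  \<comment> \<open>By this time \<open>X\<close> has moved by \<open>2 * C + 1\<close>, more than
    two values of modulus at most \<open>C\<close> can differ.\<close>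
  have "X ((2 * C + 1) / b) = X 0 + (2 * C + 1)" using X[of "(2 * C + 1) / b"] \<open>b \<noteq> 0\<close> by simp
  then show False using C[of 0] C[of "(2 * C + 1) / b"] by linarith
qed

text \<open>At an equilibrium the orbit is constant, so \<open>X\<close> has constant velocity,
  which boundedness forces to vanish. Then \<open>s = \<rho>\<close>, and all three squares in the
  energy are zero. For positive \<open>H\<close> every turning point is therefore a simple zero of
  the energy quartic.\<close>

lemma reduced_orbit_equilibrium:
  assumes orb: "reduced_orbit \<rho> H K s p X" and p0: "p t0 = 0" and G0: "s t0 * (K - (s t0)^2 / 2) - (s t0 - \<rho>) = 0"
  shows "H = 0"
proof -
  have ds: "(s has_real_derivative 1 * p t) (at t)"
    and dp: "(p has_real_derivative 1 * (s t * (K - (s t)^2 / 2) - (s t - \<rho>))) (at t)"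
    and dX: "(X has_real_derivative K - (s t)^2 / 2) (at t)"
    and en: "(p t)^2 + (K - (s t)^2 / 2)^2 + (s t - \<rho>)^2 = H" for t
    using orb unfolding reduced_orbit_def mult_1 by blast+
  obtain C where C: "\<And>t. \<bar>X t\<bar> \<le> C" using orb unfolding reduced_orbit_def by blast
  define c where "c = s t0"
  have const: "s t = c \<and> p t = 0" for t
    by (rule second_order_ode_unique[where \<theta> = "\<lambda>_. 1" and G = "\<lambda>x. x * (K - x^2 / 2) - (x - \<rho>)"
          and ?s2.0 = "\<lambda>t. c" and ?p2.0 = "\<lambda>t. 0" and ?t0.0 = t0,
          OF ds dp _ _ continuous_on_const cubic_lipschitz])
       (simp_all add: p0 G0 c_def)
  define b where "b = K - c^2/2"
  have "(X has_real_derivative b) (at t)" for t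
    using dX[of t] const[of t] by (simp add: b_def)
  from zero_of_bounded_constant_derivative[OF this C] have "b = 0" .
  then have "K - (s t0)^2 / 2 = 0" by (simp add: b_def c_def)
  with G0 have "s t0 - \<rho> = 0" by (simp only: mult_zero_right)
  with \<open>K - (s t0)^2 / 2 = 0\<close> show "H = 0" using en[of t0] p0 by (simp only: zero_power2)
qed

lemma linear_zero_at_two_points:
  fixes a d \<alpha> \<beta> :: real
  assumes "\<alpha> * a + \<beta> = 0" "\<alpha> * d + \<beta> = 0" "a \<noteq> d"
  shows "\<alpha> = 0" "\<beta> = 0"
proof -
  have "\<alpha> * (a - d) = 0" unfolding right_diff_distrib using assms by linarith
  then show "\<alpha> = 0" using assms by simp
  then show "\<beta> = 0" using assms by simp
qed

lemma periodic_attains_extrema: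
  fixes s :: "real \<Rightarrow> real"
  assumes "periodic s" "continuous_on UNIV s"
  obtains t1 t2 where "\<And>t. s t1 \<le> s t" "\<And>t. s t \<le> s t2"
proof -
  obtain \<omega> where \<omega>: "\<omega> > 0" "\<And>t. s (t + \<omega>) = s t" using assms(1) by (auto simp: periodic_def)
  have nat: "s (t + real k * \<omega>) = s t" for t k
  proof (induction k)
    case (Suc k)
    have "s (t + real (Suc k) * \<omega>) = s ((t + real k * \<omega>) + \<omega>)" by (simp add: algebra_simps)
    then show ?case using \<omega> Suc by simp
  qed simp
  have int: "s (t + of_int k * \<omega>) = s t" for t k
  proof (cases "k \<ge> 0")
    case True then show ?thesis using nat[of t "nat k"] by simp
  next
    case False then show ?thesis using nat[of "t + of_int k * \<omega>" "nat (- k)"] by simp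
  qed
  have red: "\<exists>t'\<in>{0..\<omega>}. s t' = s t" for t
  proof
    show "s (t + of_int (- \<lfloor>t / \<omega>\<rfloor>) * \<omega>) = s t" by (rule int)
    show "t + of_int (- \<lfloor>t / \<omega>\<rfloor>) * \<omega> \<in> {0..\<omega>}"
      using \<omega>(1) floor_divide_lower[OF \<omega>(1), of t] floor_divide_upper[OF \<omega>(1), of t]
      by (auto simp: algebra_simps)
  qed
  have cont: "continuous_on {0..\<omega>} s" using assms(2) continuous_on_subset by blast
  have ne: "{0..\<omega>} \<noteq> {}" using \<omega> by simp
  obtain t1 t2 where "\<forall>t\<in>{0..\<omega>}. s t1 \<le> s t" "\<forall>t\<in>{0..\<omega>}. s t \<le> s t2"
    using continuous_attains_inf[OF compact_Icc ne cont] continuous_attains_sup[OF compact_Icc ne cont] by blast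
  then show ?thesis using that red by metis
qed

context closure_path
begin

text \<open>The turning values of \<open>s\<close> determine \<sigma>, and closing up becomes
  \<open>I \<sigma> = 0\<close>. The time \<open>t0\<close> is a maximum of \<open>s\<close>; its
  phase point and \<open>K\<close> are recorded so that equal \<sigma> will give equal
  orbits.\<close>

lemma reduced_orbit_parameters:
  assumes orb: "reduced_orbit \<rho> H K s p X"
  obtains \<sigma> t0 where "admissible \<sigma>" "I \<sigma> = 0" "s t0 = \<rho>/\<sigma> + sqrt (D \<sigma>)" "p t0 = 0"
    "2 * K = k \<sigma> + (\<rho>/\<sigma>)^2"
proof -
  have ds: "(s has_real_derivative p t) (at t)"
    and dp: "(p has_real_derivative s t * (K - (s t)^2 / 2) - (s t - \<rho>)) (at t)"
    and dX: "(X has_real_derivative K - (s t)^2 / 2) (at t)"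
    and en: "(p t)^2 + (K - (s t)^2 / 2)^2 + (s t - \<rho>)^2 = H" for t
    using orb by (auto simp: reduced_orbit_def)
  obtain C where C: "\<And>t. \<bar>X t\<bar> \<le> C" using orb by (auto simp: reduced_orbit_def)
  define G where "G x = x * (K - x^2 / 2) - (x - \<rho>)" for x
  \<comment> \<open>Energy conservation makes \<open>(p t)^2\<close> a quartic in
    \<open>s t\<close>; the orbit can turn only at its zeros.\<close>
  define P where "P x = H - (K - x^2 / 2)^2 - (x - \<rho>)^2" for x
  have Pp: "P (s t) = (p t)^2" for t using en[of t] by (simp add: P_def)
  have dP: "(P has_real_derivative 2 * G x) (at x)" for x
    unfolding P_def G_def by (auto intro!: derivative_eq_intros simp: algebra_simps power2_eq_square)
  have noeq: "G (s t) \<noteq> 0" if "p t = 0" for t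
    using reduced_orbit_equilibrium[OF orb that] H by (auto simp: G_def)
  have cs: "continuous_on UNIV s" using ds by (meson DERIV_continuous_on has_field_derivative_at_within)

  \<comment> \<open>Turning points of the orbit\<close>
  obtain t1 t2 where t1: "\<And>t. s t1 \<le> s t" and t2: "\<And>t. s t \<le> s t2"
    using periodic_attains_extrema[OF _ cs] orb by (auto simp: reduced_orbit_def)
  define a where "a = s t1"
  define d where "d = s t2"
  have p1: "p t1 = 0" using DERIV_local_min[OF ds, of 1 t1] t1 by auto
  have p2: "p t2 = 0" using DERIV_local_max[OF ds, of 1 t2] t2 by auto
  have Pa: "P a = 0" "P d = 0" using Pp[of t1] Pp[of t2] p1 p2 by (auto simp: a_def d_def)
  have Ga: "G a \<noteq> 0" "G d \<noteq> 0" using noeq p1 p2 by (auto simp: a_def d_def)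
  have "a \<noteq> d"
  proof
    assume "a = d"
    then have "s t = a" for t using t1[of t] t2[of t] by (simp add: a_def d_def)
    then have "s = (\<lambda>_. a)" by auto
    then have "p t = 0" for t using ds[of t] DERIV_unique[OF _ DERIV_const] by auto
    then have "p = (\<lambda>_. 0)" by auto
    then have "(p has_real_derivative 0) (at t1)" by simp
    from DERIV_unique[OF dp this] have "G (s t1) = 0" by (simp add: G_def)
    then show False using noeq p1 by blast
  qed
  then have ad: "a < d" using t1[of t2] by (simp add: a_def d_def)
  have range: "\<exists>t. s t = x" if "a \<le> x" "x \<le> d" for x
  proof (cases "t1 \<le> t2")
    case True then show ?thesis using IVT'[of s t1 x t2] that cs continuous_on_subset by (fastforce simp: a_def d_def)
  next
    case False then show ?thesis using IVT2'[of s t1 x t2] that cs continuous_on_subset by (fastforce simp: a_def d_def)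
  qed
  have P0: "0 \<le> P x" if "a \<le> x" "x \<le> d" for x using range[OF that] Pp by (metis zero_le_power2)
  \<comment> \<open>An interior zero would be a minimum of the nonnegative \<open>P\<close>, hence
    an equilibrium on the orbit.\<close>
  have Ppos: "0 < P x" if "a < x" "x < d" for x
  proof (rule ccontr)
    assume "\<not> 0 < P x"
    then have Px: "P x = 0" using P0[of x] that by auto
    have "2 * G x = 0"
    proof (rule DERIV_local_min[OF dP])
      show "0 < min (x - a) (d - x)" using that by simp
      show "\<forall>y. \<bar>x - y\<bar> < min (x - a) (d - x) \<longrightarrow> P x \<le> P y" using P0 Px by auto
    qed
    moreover obtain t where "s t = x" using range[of x] \<open>a < x\<close> \<open>x < d\<close> by (meson less_imp_le)
    ultimately show False using Pp[of t] Px noeq[of t] by auto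
  qed

  \<comment> \<open>Factoring the quartic\<close>
  define m where "m = (a + d)/2"
  define \<delta> where "\<delta> = (d - a)/2"
  \<comment> \<open>This choice matches the coefficients of \<open>x^2\<close>; those of degree 3
    and 4 agree anyway. The remaining difference is affine and vanishes at both \<open>a\<close> and
    \<open>d\<close>, hence everywhere.\<close>
  define b where "b = \<delta>^2 + 2*m^2 - 4*(K - 1)"
  have a: "a = m - \<delta>" and d: "d = m + \<delta>" by (auto simp: m_def \<delta>_def field_simps)
  have \<delta>: "0 < \<delta>" using ad by (simp add: \<delta>_def)
  have diff: "P x - (\<delta>^2 - (x - m)^2) * ((x + m)^2 + b) / 4
      = (2*\<rho> - m*(\<delta>^2 + b)/2) * x + (H - \<rho>^2 - K^2 - (\<delta>^2 - m^2)*(m^2 + b)/4)" for x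
    unfolding P_def b_def by (simp add: field_simps) algebra
  have "2*\<rho> - m*(\<delta>^2 + b)/2 = 0" "H - \<rho>^2 - K^2 - (\<delta>^2 - m^2)*(m^2 + b)/4 = 0"
    using linear_zero_at_two_points[of "2*\<rho> - m*(\<delta>^2 + b)/2" a "H - \<rho>^2 - K^2 - (\<delta>^2 - m^2)*(m^2 + b)/4" d]
      diff[of a] diff[of d] Pa \<open>a \<noteq> d\<close> by (auto simp: a d)
  then have coeff: "m*(\<delta>^2 + b) = 4*\<rho>" "H = \<rho>^2 + K^2 + (\<delta>^2 - m^2)*(m^2 + b)/4" by auto
  have Pfac: "P x = (\<delta>^2 - (x - m)^2) * ((x + m)^2 + b) / 4" for x
    using diff[of x] coeff by simp
  define Q where "Q x = (x + m)^2 + b" for x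
  have Qpos: "0 < Q x" if "a < x" "x < d" for x
  proof -
    have "0 < (x - a) * (d - x)" using that by simp
    also have "\<dots> = \<delta>^2 - (x - m)^2" unfolding a d by algebra
    finally have "0 < \<delta>^2 - (x - m)^2" .
    then show ?thesis using Ppos[OF that] by (simp add: Pfac Q_def zero_less_mult_iff)
  qed
  have dP2: "2 * G x = (- 2*(x - m) * Q x + (\<delta>^2 - (x - m)^2) * (2*(x + m))) / 4" for x
  proof -
    have "P = (\<lambda>x. (\<delta>^2 - (x - m)^2) * ((x + m)^2 + b) / 4)" using Pfac by auto
    moreover have "((\<lambda>x. (\<delta>^2 - (x - m)^2) * ((x + m)^2 + b) / 4) has_real_derivative
        (- 2*(x - m) * Q x + (\<delta>^2 - (x - m)^2) * (2*(x + m))) / 4) (at x)"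
      unfolding Q_def by (auto intro!: derivative_eq_intros)
    ultimately show ?thesis using dP[of x] DERIV_unique by metis
  qed
  \<comment> \<open>The first factor vanishes at \<open>a\<close> and \<open>d\<close>, so a zero of
    \<open>Q\<close> there would be a double zero of \<open>P\<close>, that is, an
    equilibrium.\<close>
  have Qne: "Q a \<noteq> 0" "Q d \<noteq> 0" using dP2[of a] dP2[of d] Ga by (auto simp: a d)
  have "0 \<le> Q x" if "x \<in> {a..d}" for x
  proof (rule continuous_ge_on_Ioo[of a d Q 0])
    show "continuous_on {a..d} Q" unfolding Q_def by (intro continuous_intros)
  qed (use that ad Qpos less_imp_le in auto)
  then have Q0: "0 < Q x" if "x \<in> {a..d}" for x
    using that Qpos[of x] Qne by (metis atLeastAtMost_iff order_le_less)

  \<comment> \<open>The angle as a new time variable\<close>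
  define y where "y \<phi> = 2*m + \<delta> * cos \<phi>" for \<phi>
  have q0: "0 < (y \<phi>)^2 + b" for \<phi>
  proof -
    have "\<bar>\<delta> * cos \<phi>\<bar> \<le> \<delta>" using \<delta> by (simp add: abs_mult mult_left_le)
    then have "m + \<delta> * cos \<phi> \<in> {a..d}" by (auto simp: a d)
    from Q0[OF this] show ?thesis by (simp add: Q_def y_def algebra_simps)
  qed
  define q where "q \<phi> = (y \<phi>)^2 + b" for \<phi>
  have q: "0 < q \<phi>" for \<phi> using q0 by (simp add: q_def)
  \<comment> \<open>This is dt/d\<phi>: along \<open>s = m + \<delta> * cos \<phi>\<close> the
    velocity is to be \<open>- (\<delta> * sin \<phi>) * sqrt (q \<phi>) / 2\<close>.\<close>
  define \<theta> where "\<theta> \<phi> = 2 / sqrt (q \<phi>)" for \<phi>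
  have c\<theta>: "continuous_on UNIV \<theta>"
  proof -
    have "continuous_on UNIV q" unfolding q_def y_def by (intro continuous_intros)
    then show ?thesis unfolding \<theta>_def using q by (intro continuous_intros) (auto simp: less_imp_neq[symmetric])
  qed
  obtain \<Theta> where \<Theta>: "\<And>\<phi>. (\<Theta> has_real_derivative \<theta> \<phi>) (at \<phi>)"
    using einterval_antiderivative[of "-\<infinity>" "\<infinity>" \<theta>] c\<theta>
    by (auto simp: continuous_on_eq_continuous_at has_real_derivative_iff_has_vector_derivative)
  \<comment> \<open>Angle 0 is placed at the maximum of \<open>s\<close>.\<close>
  define T where "T \<phi> = t2 + (\<Theta> \<phi> - \<Theta> 0)" for \<phi>
  have dT: "(T has_real_derivative \<theta> \<phi>) (at \<phi>)" for \<phi>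
    unfolding T_def by (auto intro!: derivative_eq_intros \<Theta>)
  \<comment> \<open>Both sides solve the same system in \<phi>, so uniqueness identifies them; no
    square root of \<open>P\<close> has to be followed through the turning points.\<close>
  have cS: "s (T \<phi>) = m + \<delta> * cos \<phi> \<and> p (T \<phi>) = - (\<delta> * sin \<phi>) * sqrt (q \<phi>) / 2" for \<phi>
  proof (rule second_order_ode_unique[where \<theta> = \<theta> and G = G
        and ?s1.0 = "\<lambda>\<phi>. s (T \<phi>)" and ?p1.0 = "\<lambda>\<phi>. p (T \<phi>)" and ?s2.0 = "\<lambda>\<phi>. m + \<delta> * cos \<phi>"
        and ?p2.0 = "\<lambda>\<phi>. - (\<delta> * sin \<phi>) * sqrt (q \<phi>) / 2" and ?t0.0 = 0])
    show "((\<lambda>\<phi>. s (T \<phi>)) has_real_derivative \<theta> \<phi> * p (T \<phi>)) (at \<phi>)" for \<phi>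
      using DERIV_chain2[OF ds dT] by (simp add: mult.commute)
    show "((\<lambda>\<phi>. p (T \<phi>)) has_real_derivative \<theta> \<phi> * G (s (T \<phi>))) (at \<phi>)" for \<phi>
      using DERIV_chain2[OF dp dT] by (simp add: mult.commute G_def)
    show "((\<lambda>\<phi>. m + \<delta> * cos \<phi>) has_real_derivative \<theta> \<phi> * (- (\<delta> * sin \<phi>) * sqrt (q \<phi>) / 2)) (at \<phi>)" for \<phi>
      using q[of \<phi>] by (auto intro!: derivative_eq_intros simp: \<theta>_def)
    show "((\<lambda>\<phi>. - (\<delta> * sin \<phi>) * sqrt (q \<phi>) / 2) has_real_derivative \<theta> \<phi> * G (m + \<delta> * cos \<phi>)) (at \<phi>)" for \<phi>
    proof -
      define r where "r = sqrt (q \<phi>)"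
      have r: "0 < r" "r^2 = q \<phi>" using q[of \<phi>] by (auto simp: r_def)
      have "(q has_real_derivative 2 * y \<phi> * (- (\<delta> * sin \<phi>))) (at \<phi>)"
        unfolding q_def y_def by (auto intro!: derivative_eq_intros)
      from DERIV_chain2[OF DERIV_real_sqrt[OF q] this]
      have dr: "((\<lambda>\<phi>. sqrt (q \<phi>)) has_real_derivative inverse r / 2 * (2 * y \<phi> * (- (\<delta> * sin \<phi>)))) (at \<phi>)"
        by (simp add: r_def)
      have "((\<lambda>\<phi>. - (\<delta> * sin \<phi>)) has_real_derivative - (\<delta> * cos \<phi>)) (at \<phi>)"
        by (auto intro!: derivative_eq_intros)
      from DERIV_cdivide[OF DERIV_mult[OF this dr], of 2]
      have "((\<lambda>\<phi>. - (\<delta> * sin \<phi>) * sqrt (q \<phi>) / 2) has_real_derivative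
         (- (\<delta> * cos \<phi>) * r + inverse r / 2 * (2 * y \<phi> * (- (\<delta> * sin \<phi>))) * - (\<delta> * sin \<phi>)) / 2) (at \<phi>)"
        by (simp add: r_def)
      moreover have "(- (\<delta> * cos \<phi>) * r + inverse r / 2 * (2 * y \<phi> * (- (\<delta> * sin \<phi>))) * - (\<delta> * sin \<phi>)) / 2
         = (2 / r) * ((- (\<delta> * cos \<phi>) * r^2 + (\<delta> * sin \<phi>)^2 * y \<phi>) / 4)"
        using r(1) by (simp add: field_simps power2_eq_square)
      moreover have "(- (\<delta> * cos \<phi>) * r^2 + (\<delta> * sin \<phi>)^2 * y \<phi>) / 4 = G (m + \<delta> * cos \<phi>)"
      proof -
        define c where "c = \<delta> * cos \<phi>"
        have sc: "(\<delta> * sin \<phi>)^2 = \<delta>^2 - c^2"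
          by (simp add: c_def power_mult_distrib sin_squared_eq algebra_simps)
        have rQ: "r^2 = Q (m + c)" and yc: "y \<phi> = 2*m + c"
          by (simp_all add: r(2) Q_def q_def y_def c_def algebra_simps)
        have "8 * G (m + c) = - 2 * c * Q (m + c) + (\<delta>^2 - c^2) * (2 * (2*m + c))"
          using dP2[of "m + c"] by simp
        then show ?thesis unfolding c_def[symmetric] sc rQ yc by (simp add: algebra_simps)
      qed
      ultimately show ?thesis unfolding \<theta>_def r_def[symmetric] by (simp only:)
    qed
    show "continuous_on UNIV \<theta>" by fact
    show "\<exists>L. \<forall>a b. \<bar>a\<bar> \<le> M \<longrightarrow> \<bar>b\<bar> \<le> M \<longrightarrow> \<bar>G a - G b\<bar> \<le> L * \<bar>a - b\<bar>" for M
      unfolding G_def by (rule cubic_lipschitz)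
    show "s (T 0) = m + \<delta> * cos 0" "p (T 0) = - (\<delta> * sin 0) * sqrt (q 0) / 2"
      using p2 by (simp_all add: T_def d[symmetric] d_def)
  qed

  \<comment> \<open>The closing condition and its parameters\<close>
  define \<kappa> where "\<kappa> = 2*K - m^2"
  have "integral {0..2*pi} (\<lambda>\<phi>. (\<kappa> + 2*m*y \<phi> - (y \<phi>)^2) / sqrt (q \<phi>)) = 0"
  proof (rule integral_zero_of_bounded_primitive[where X = "\<lambda>\<phi>. X (T \<phi>)"])
    show "\<bar>X (T \<phi>)\<bar> \<le> C" for \<phi> by (rule C)
    show "(\<kappa> + 2*m*y (\<phi> + 2 * pi) - (y (\<phi> + 2 * pi))^2) / sqrt (q (\<phi> + 2 * pi)) = (\<kappa> + 2*m*y \<phi> - (y \<phi>)^2) / sqrt (q \<phi>)" for \<phi>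
      by (simp add: y_def q_def)
    \<comment> \<open>As \<open>s = y - m\<close>, twice the velocity of \<open>X\<close> is
      \<open>\<kappa> + 2*m*y - y^2\<close>.\<close>
    have "(K - (s (T \<phi>))^2 / 2) * \<theta> \<phi> = (\<kappa> + 2*m*y \<phi> - (y \<phi>)^2) / sqrt (q \<phi>)" for \<phi>
      using cS[of \<phi>] by (simp add: \<theta>_def y_def \<kappa>_def diff_divide_distrib power2_eq_square algebra_simps add_divide_distrib)
    then show "((\<lambda>\<phi>. X (T \<phi>)) has_real_derivative (\<kappa> + 2*m*y \<phi> - (y \<phi>)^2) / sqrt (q \<phi>)) (at \<phi>)" for \<phi>
      using DERIV_chain2[OF dX dT, of \<phi>] by simp
  qed
  then have closed: "closure_integral m \<delta> b \<kappa> = 0"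
    by (simp add: closure_integral_def y_def q_def)
  have \<kappa>2: "2*\<kappa> = 4 + \<delta>^2 - b" by (simp add: \<kappa>_def b_def)
  note pos = closure_integral_zero_imp[OF q0[unfolded y_def] \<delta> \<kappa>2 closed]
  \<comment> \<open>With this choice the first coefficient equation reads
    \<open>m * \<sigma> = \<rho>\<close>.\<close>
  define \<sigma> where "\<sigma> = (\<delta>^2 + b)/4"
  have \<sigma>: "0 < \<sigma>" using pos(1) \<delta> by (simp add: \<sigma>_def add_nonneg_pos)
  have m: "\<rho>/\<sigma> = m" using coeff(1) \<sigma> by (simp add: \<sigma>_def field_simps)
  have n\<sigma>: "n \<sigma> = m^2" by (simp add: n_def m)
  have b\<sigma>: "b = 2*(\<sigma>+1) - \<kappa>" and \<delta>\<sigma>: "\<delta>^2 = 2*(\<sigma>-1) + \<kappa>" using \<kappa>2 by (auto simp: \<sigma>_def field_simps)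
  have "H = (1 + m^2) * (\<kappa> - 1 + \<sigma>^2)"
  proof -
    have "\<rho> = m * \<sigma>" "2*K = \<kappa> + m^2" using m \<sigma> by (auto simp: \<kappa>_def)
    then have "K = (\<kappa> + m^2)/2" by simp
    show ?thesis unfolding coeff(2) b\<sigma> \<delta>\<sigma> \<open>\<rho> = m * \<sigma>\<close> \<open>K = _\<close> by (simp add: field_simps) algebra
  qed
  moreover have "0 < 1 + m^2" by (simp add: add_pos_nonneg)
  ultimately have "H / (1 + m^2) = \<kappa> - 1 + \<sigma>^2" by simp
  then have k\<sigma>: "k \<sigma> = \<kappa>" by (simp add: k_def n\<sigma>)
  have B\<sigma>: "B \<sigma> = b" and D\<sigma>: "D \<sigma> = \<delta>^2" by (simp_all add: B_def D_def k\<sigma> b\<sigma> \<delta>\<sigma>)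
  \<comment> \<open>The discriminant bound, rewritten in \<sigma> and \<kappa>.\<close>
  have z: "0 \<le> \<sigma>^2 - 1 - m^2 * \<kappa>"
  proof -
    have "4*m^2*b - (\<kappa> + b) * (\<kappa> - \<delta>^2 + 4*m^2) = 4 * (\<sigma>^2 - 1 - m^2 * \<kappa>)"
      unfolding b\<sigma> \<delta>\<sigma> by algebra
    then show ?thesis using pos(3) by simp
  qed
  have "1 \<le> \<sigma>^2" using z pos(2) by (smt (verit) mult_nonneg_nonneg zero_le_power2)
  then have "1 \<le> \<sigma>" using \<sigma> by (metis less_imp_le one_le_power power2_le_imp_le power_one)
  then have "admissible \<sigma>" using pos z by (simp add: admissible_def k\<sigma> B\<sigma> n\<sigma>)
  moreover have "I \<sigma> = 0" using closed \<delta> by (simp add: I_def m k\<sigma> B\<sigma> D\<sigma>)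
  moreover have "s t2 = \<rho>/\<sigma> + sqrt (D \<sigma>)" using \<delta> by (simp add: m D\<sigma> d[symmetric] d_def)
  moreover have "2 * K = k \<sigma> + (\<rho>/\<sigma>)^2" by (simp add: m k\<sigma> \<kappa>_def)
  ultimately show ?thesis using that p2 by blast
qed

end

text \<open>For \<open>H = 0\<close> both orbits rest at \<open>s = \<rho>\<close>. Otherwise
  \<open>closure_unique\<close> gives a common \<sigma>, which fixes \<open>K\<close> and the phase
  point at the maximum of \<open>s\<close>; aligning the two maxima gives the shift.\<close>

theorem reduced_orbit_unique:
  assumes o1: "reduced_orbit \<rho> H K1 s1 p1 X1" and o2: "reduced_orbit \<rho> H K2 s2 p2 X2"
  shows "K1 = K2 \<and> (\<exists>\<tau>. \<forall>t. s2 t = s1 (t + \<tau>) \<and> p2 t = p1 (t + \<tau>))"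
proof (cases "H = 0")
  case True
  have "s t = \<rho> \<and> p t = 0 \<and> K = \<rho>^2/2" if "reduced_orbit \<rho> H K s p X" for K s p X t
  proof -
    have "(p t)^2 + (K - (s t)^2 / 2)^2 + (s t - \<rho>)^2 = 0"
      using that True by (auto simp: reduced_orbit_def)
    then have "p t = 0" "K - (s t)^2 / 2 = 0" "s t - \<rho> = 0"
      by (smt (verit) zero_le_power2 zero_eq_power2)+
    then show ?thesis by simp
  qed
  from this[OF o1] this[OF o2] show ?thesis by metis
next
  case False
  have "0 \<le> H" using o1 unfolding reduced_orbit_def by (metis add_nonneg_nonneg zero_le_power2)
  then interpret closure_path \<rho> H using False by unfold_locales simp
  obtain \<sigma>1 t1 where 1: "admissible \<sigma>1" "I \<sigma>1 = 0" "s1 t1 = \<rho>/\<sigma>1 + sqrt (D \<sigma>1)" "p1 t1 = 0"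
    "2 * K1 = k \<sigma>1 + (\<rho>/\<sigma>1)^2" by (rule reduced_orbit_parameters[OF o1])
  obtain \<sigma>2 t2 where 2: "admissible \<sigma>2" "I \<sigma>2 = 0" "s2 t2 = \<rho>/\<sigma>2 + sqrt (D \<sigma>2)" "p2 t2 = 0"
    "2 * K2 = k \<sigma>2 + (\<rho>/\<sigma>2)^2" by (rule reduced_orbit_parameters[OF o2])
  have eq: "\<sigma>1 = \<sigma>2" using closure_unique 1 2 by blast
  then have K: "K1 = K2" using 1(5) 2(5) by simp
  have "s2 t = s1 (t + (t1 - t2)) \<and> p2 t = p1 (t + (t1 - t2))" for t
    using reduced_orbit_equal[OF o1 o2[folded K], of t1 t2 "t - t2"] 1 2 eq by (simp add: algebra_simps)
  then show ?thesis using K by blast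
qed

section \<open>Heisenberg geometry\<close>

lemma vec3_eq_iff: "u = v \<longleftrightarrow> u$1 = v$1 \<and> u$2 = v$2 \<and> u$3 = v$3" for u v :: "real^3"
  by (simp add: vec_eq_iff forall_3)

section \<open>The Levi-Civita connection in coordinates\<close>

lemma heis_gram:
  "gram heis_metric p = vector [vector [1 + (p$2)^2/4, - (p$1 * p$2)/4, p$2/2],
     vector [- (p$1 * p$2)/4, 1 + (p$1)^2/4, - p$1/2], vector [p$2/2, - p$1/2, 1]]"
  by (simp add: gram_def vec_eq_iff forall_3 heis_metric_def heis_coeffs_def inner_vec_def sum_3 axis_def
      power2_eq_square)

lemma heis_gram_inv:
  "matrix_inv (gram heis_metric p) = vector [vector [1, 0, - p$2/2],
     vector [0, 1, p$1/2], vector [- p$2/2, p$1/2, 1 + ((p$1)^2 + (p$2)^2)/4]]" (is "_ = ?B")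
proof -
  have 1: "gram heis_metric p ** ?B = mat 1"
    by (simp add: heis_gram vec_eq_iff forall_3 matrix_matrix_mult_def sum_3 mat_def
        power2_eq_square field_simps)
  then have 2: "?B ** gram heis_metric p = mat 1" using matrix_left_right_inverse by blast
  \<comment> \<open>\<open>matrix_inv\<close> is defined by choice, so it is identified by
    multiplying with the explicit inverse.\<close>
  have "gram heis_metric p ** matrix_inv (gram heis_metric p) = mat 1"
    unfolding matrix_inv_def using someI[of "\<lambda>A. gram heis_metric p ** A = mat 1 \<and> A ** gram heis_metric p = mat 1"] 1 2
    by blast
  then have "(?B ** gram heis_metric p) ** matrix_inv (gram heis_metric p) = ?B"
    by (simp add: matrix_mul_assoc[symmetric] matrix_mul_rid)
  then show ?thesis unfolding 2 matrix_mul_lid .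
qed

lemma frechet_derivative_eq: "(f has_derivative f') (at p) \<Longrightarrow> frechet_derivative f (at p) = f'"
  by (rule frechet_derivative_at[symmetric])

lemma has_derivative_vec_nth: "((\<lambda>q. q $ i) has_derivative (\<lambda>h. h $ i)) (at p)"
  by (rule bounded_linear_imp_has_derivative[OF bounded_linear_vec_nth])

text \<open>These shapes cover all nonconstant entries of the Gram matrix.\<close>

lemma heis_gram_entry_derivatives:
  fixes p h :: "real^3"
  shows "frechet_derivative (\<lambda>q. 1 + (q$i)^2/4) (at p) h = p$i * h$i / 2"
    and "frechet_derivative (\<lambda>q. - (q$1 * q$2)/4) (at p) h = - (h$1 * p$2 + p$1 * h$2) / 4"
    and "frechet_derivative (\<lambda>q. q$i/2) (at p) h = h$i / 2"
    and "frechet_derivative (\<lambda>q. - q$i/2) (at p) h = - h$i / 2"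
proof -
  have "((\<lambda>q. 1 + (q$i)^2/4) has_derivative (\<lambda>h. p$i * h$i / 2)) (at p)"
    by (rule derivative_eq_intros has_derivative_vec_nth refl | simp add: mult.commute)+
  then show "frechet_derivative (\<lambda>q. 1 + (q$i)^2/4) (at p) h = p$i * h$i / 2"
    by (simp add: frechet_derivative_eq)
  have "((\<lambda>q. - (q$1 * q$2)/4) has_derivative (\<lambda>h. - (p$1 * h$2 + h$1 * p$2) / 4)) (at p)"
    using bounded_linear.has_derivative[OF bounded_linear_divide[of 4] has_derivative_minus[OF
        has_derivative_mult[OF has_derivative_vec_nth has_derivative_vec_nth, of 1 2 p]]] by simp
  then show "frechet_derivative (\<lambda>q. - (q$1 * q$2)/4) (at p) h = - (h$1 * p$2 + p$1 * h$2) / 4"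
    by (simp add: frechet_derivative_eq)
  have "((\<lambda>q. q$i/2) has_derivative (\<lambda>h. h$i / 2)) (at p)" "((\<lambda>q. - q$i/2) has_derivative (\<lambda>h. - h$i / 2)) (at p)"
    using bounded_linear.has_derivative[OF bounded_linear_divide[of 2] has_derivative_vec_nth[of i p]]
      bounded_linear.has_derivative[OF bounded_linear_divide[of 2] has_derivative_minus[OF has_derivative_vec_nth[of i p]]]
    by simp_all
  from this[THEN frechet_derivative_eq]
  show "frechet_derivative (\<lambda>q. q$i/2) (at p) h = h$i / 2" "frechet_derivative (\<lambda>q. - q$i/2) (at p) h = - h$i / 2"
    by simp_all
qed

lemma heis_partial_gram:
  "partial_gram heis_metric p i 1 1 = p$2 * axis i 1 $ 2 / 2"
  "partial_gram heis_metric p i 2 2 = p$1 * axis i 1 $ 1 / 2"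
  "partial_gram heis_metric p i 3 3 = 0"
  "partial_gram heis_metric p i 1 2 = - (axis i 1 $ 1 * p$2 + p$1 * axis i 1 $ 2) / 4"
  "partial_gram heis_metric p i 2 1 = - (axis i 1 $ 1 * p$2 + p$1 * axis i 1 $ 2) / 4"
  "partial_gram heis_metric p i 1 3 = axis i 1 $ 2 / 2"
  "partial_gram heis_metric p i 3 1 = axis i 1 $ 2 / 2"
  "partial_gram heis_metric p i 2 3 = - axis i 1 $ 1 / 2"
  "partial_gram heis_metric p i 3 2 = - axis i 1 $ 1 / 2"
  unfolding partial_gram_def heis_gram vector_3 heis_gram_entry_derivatives
  by simp_all

text \<open>The result is horizontal: it is \<open>c\<close> times
  \<open>v$2 *\<^sub>R heis_e1 p - v$1 *\<^sub>R heis_e2 p\<close>. In the frame the connection thus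
  only rotates the horizontal velocity, at the rate of the vertical one.\<close>

lemma heis_christoffel_term:
  assumes c: "c = heis_coeffs p v $ 3"
  shows "(\<chi> k. \<Sum>i\<in>UNIV. \<Sum>j\<in>UNIV. christoffel heis_metric p k i j * v$i * v$j)
    = vector [v$2 * c, - v$1 * c, - (p$2 * v$2 + p$1 * v$1) * c / 2]"
  unfolding c
  by (simp add: vec3_eq_iff christoffel_def sum_3 heis_partial_gram heis_gram_inv heis_coeffs_def axis_def
      power2_eq_square field_simps)


section \<open>Left translations\<close>

lemma heis_mult_components:
  "heis_mult a b $ 1 = a$1 + b$1" "heis_mult a b $ 2 = a$2 + b$2"
  "heis_mult a b $ 3 = a$3 + b$3 + (1/2) * (a$1 * b$2 - b$1 * a$2)"
  by (simp_all add: heis_mult_def)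

lemma heis_coeffs_components:
  "heis_coeffs p u $ 1 = u$1" "heis_coeffs p u $ 2 = u$2"
  "heis_coeffs p u $ 3 = u$3 + (1/2) * (p$2 * u$1 - p$1 * u$2)"
  by (simp_all add: heis_coeffs_def)

lemma heis_coeffs_left_invariant: "heis_coeffs (heis_mult a p) (differential (heis_mult a) p v) = heis_coeffs p v"
  by (simp add: differential_heis_mult vec3_eq_iff heis_coeffs_components heis_mult_components algebra_simps)

lemma heis_mult_inverse: "heis_mult a (heis_mult (- a) p) = p" "heis_mult (- a) (heis_mult a p) = p"
  by (simp_all add: vec3_eq_iff heis_mult_components algebra_simps)

lemma inv_heis_mult: "inv (heis_mult a) = heis_mult (- a)"
  by (rule inv_unique_comp) (auto simp: fun_eq_iff heis_mult_inverse)

lemma C_class_const: "C_class k (\<lambda>p. c)"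
  by (induction k arbitrary: c) auto

lemma differentiable_heis_mult: "heis_mult a differentiable (at p)"
proof -
  let ?L = "\<lambda>b::real^3. b + vector [0, 0, (1/2) * (a$1 * b$2 - b$1 * a$2)] :: real^3"
  have eq: "heis_mult a = (\<lambda>b. a + ?L b)"
    by (simp add: fun_eq_iff vec3_eq_iff heis_mult_components)
  have "linear ?L"
    by (rule linearI) (simp_all add: vec3_eq_iff algebra_simps)
  then show ?thesis
    unfolding eq by (rule differentiable_add[OF differentiable_const linear_imp_differentiable])
qed

text \<open>A left translation is affine, so its directional derivatives are constant
  functions.\<close>

lemma smooth_heis_mult: "smooth (heis_mult a)"
proof -
  have "C_class k (heis_mult a)" for k
  proof (cases k)
    case 0
    then show ?thesis
      by (simp add: differentiable_imp_continuous_on differentiable_on_def differentiable_heis_mult)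
  next
    case (Suc j)
    then show ?thesis by (simp add: differentiable_heis_mult differential_heis_mult C_class_const)
  qed
  then show ?thesis by (simp add: smooth_def)
qed

lemma isometry_heis_mult: "isometry heis_metric (heis_mult a)"
proof -
  have "bij (heis_mult a)"
    by (rule o_bij[of "heis_mult (- a)"]) (auto simp: fun_eq_iff heis_mult_inverse)
  then show ?thesis
    by (simp add: isometry_def diffeomorphism_def inv_heis_mult smooth_heis_mult heis_metric_def heis_coeffs_left_invariant)
qed

text \<open>For \<open>r = 1\<close>, left-invariance at the preimage of \<open>q\<close> is the
  fixed-point equation for \<open>F\<close>.\<close>

lemma heis_mult_in_isotropy:
  assumes "left_invariant F"
  shows "(heis_mult a, 1) \<in> isotropy F"
proof -
  have "act_force (heis_mult a, 1) F q v = F q v" for q v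
  proof -
    let ?p = "heis_mult (- a) q" and ?u = "differential (heis_mult (- a)) q v"
    have "differential (heis_mult a) ?p (F ?p ?u) = F (heis_mult a ?p) (differential (heis_mult a) ?p ?u)"
      using assms by (simp add: left_invariant_def)
    also have "differential (heis_mult a) ?p ?u = v"
      by (simp add: differential_heis_mult vec3_eq_iff field_simps)
    finally show ?thesis by (simp add: inv_heis_mult heis_mult_inverse)
  qed
  then show ?thesis by (auto simp: isotropy_def iso_scale_def isometry_heis_mult fun_eq_iff)
qed

text \<open>Translation to the origin, where frame coefficients are the coordinates themselves,
  shows that \<open>F\<close> has a constant matrix in the frame.\<close>

lemma left_invariant_frame:
  assumes "left_invariant F"
  shows "heis_coeffs p (F p v) = F 0 (heis_coeffs p v)"
proof -
  have 0: "heis_mult p 0 = p" by (simp add: vec3_eq_iff heis_mult_components)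
  have "differential (heis_mult p) 0 (heis_coeffs p v) = v"
    by (simp add: differential_heis_mult vec3_eq_iff heis_coeffs_components algebra_simps)
  then have "F p v = differential (heis_mult p) 0 (F 0 (heis_coeffs p v))"
    using assms 0 unfolding left_invariant_def by metis
  then have "heis_coeffs p (F p v) = heis_coeffs 0 (F 0 (heis_coeffs p v))"
    using heis_coeffs_left_invariant[of p 0] 0 by simp
  moreover have "heis_coeffs 0 u = u" for u by (simp add: vec3_eq_iff heis_coeffs_components)
  ultimately show ?thesis by simp
qed

text \<open>Skew-symmetry at the origin makes \<open>F 0\<close> the cross product with a fixed
  vector, whose entries are \<open>f 2 $ 3\<close>, \<open>f 3 $ 1\<close>,
  \<open>f 1 $ 2\<close>.\<close>

lemma lorentz_force_frame:
  assumes "left_invariant_lorentz_force F"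
  shows "\<exists>w1 w2 w3. \<forall>p v. heis_coeffs p (F p v) $ 1 = w2 * heis_coeffs p v $ 3 - w3 * v$2 \<and>
    heis_coeffs p (F p v) $ 2 = w3 * v$1 - w1 * heis_coeffs p v $ 3 \<and>
    heis_coeffs p (F p v) $ 3 = w1 * v$2 - w2 * v$1"
proof -
  have c0: "heis_coeffs 0 u = u" for u by (simp add: vec3_eq_iff heis_coeffs_components)
  have inv: "left_invariant F" and "heis_metric 0 (F 0 u) v = - heis_metric 0 u (F 0 v)" for u v
    using assms unfolding left_invariant_lorentz_force_def by blast+
  then have skew: "F 0 u \<bullet> v = - (u \<bullet> F 0 v)" for u v by (simp add: heis_metric_def c0)
  define f where "f i = F 0 (axis i 1)" for i
  have comp: "F 0 u $ i = - (u$1 * f i $ 1 + u$2 * f i $ 2 + u$3 * f i $ 3)" for u i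
    using skew[of u "axis i 1"] unfolding f_def[symmetric] by (simp add: inner_axis inner_vec_def[of u] sum_3)
  have anti: "f i $ j = - f j $ i" for i j
    using skew[of "axis i 1" "axis j 1"] by (simp add: inner_axis f_def inner_axis')
  have diag: "f i $ i = 0" for i using anti[of i i] by simp
  have "heis_coeffs p (F p v) $ 1 = f 3 $ 1 * heis_coeffs p v $ 3 - f 1 $ 2 * v$2" for p v
    using anti[of 2 1] by (simp add: left_invariant_frame[OF inv] comp diag anti[of 1 3] heis_coeffs_components(1,2) algebra_simps)
  moreover have "heis_coeffs p (F p v) $ 2 = f 1 $ 2 * v$1 - f 2 $ 3 * heis_coeffs p v $ 3" for p v
    by (simp add: left_invariant_frame[OF inv] comp diag anti[of 2 1] heis_coeffs_components(1,2) algebra_simps)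
  moreover have "heis_coeffs p (F p v) $ 3 = f 2 $ 3 * v$2 - f 3 $ 1 * v$1" for p v
    by (simp add: left_invariant_frame[OF inv] comp diag anti[of 3 2] heis_coeffs_components(1,2) algebra_simps)
  ultimately show ?thesis by blast
qed

section \<open>Equations of motion in the frame\<close>

lemma vec_nth_derivative:
  "(f has_vector_derivative f') (at t) \<Longrightarrow> ((\<lambda>t. f t $ i) has_real_derivative f' $ i) (at t)"
  unfolding has_real_derivative_iff_has_vector_derivative
  by (rule bounded_linear.has_vector_derivative[OF bounded_linear_vec_nth])

text \<open>Here \<open>u\<close> is the velocity of \<open>\<gamma>\<close> in the left-invariant frame, and the force is \<open>u \<mapsto> w \<times> u\<close>.\<close>

definition frame_equations ::
    "real \<Rightarrow> real \<Rightarrow> real \<Rightarrow> (real \<Rightarrow> real^3) \<Rightarrow> (real \<Rightarrow> real^3) \<Rightarrow> bool" where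
  "frame_equations w1 w2 w3 \<gamma> u \<longleftrightarrow> (\<forall>t.
     ((\<lambda>t. \<gamma> t $ 1) has_real_derivative u t $ 1) (at t) \<and>
     ((\<lambda>t. \<gamma> t $ 2) has_real_derivative u t $ 2) (at t) \<and>
     ((\<lambda>t. \<gamma> t $ 3) has_real_derivative u t $ 3 - (\<gamma> t $ 2 * u t $ 1 - \<gamma> t $ 1 * u t $ 2) / 2) (at t) \<and>
     ((\<lambda>t. u t $ 1) has_real_derivative w2 * u t $ 3 - (u t $ 3 + w3) * u t $ 2) (at t) \<and>
     ((\<lambda>t. u t $ 2) has_real_derivative (u t $ 3 + w3) * u t $ 1 - w1 * u t $ 3) (at t) \<and>
     ((\<lambda>t. u t $ 3) has_real_derivative w1 * u t $ 2 - w2 * u t $ 1) (at t))"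

text \<open>The connection acts like an additional vertical field of strength
  \<open>u t $ 3\<close>, hence the sum \<open>u t $ 3 + w3\<close> in the equations.\<close>

lemma magnetic_trajectory_frame_equations:
  assumes traj: "magnetic_trajectory F \<gamma>"
    and F1: "\<And>p v. heis_coeffs p (F p v) $ 1 = w2 * heis_coeffs p v $ 3 - w3 * v$2"
    and F2: "\<And>p v. heis_coeffs p (F p v) $ 2 = w3 * v$1 - w1 * heis_coeffs p v $ 3"
    and F3: "\<And>p v. heis_coeffs p (F p v) $ 3 = w1 * v$2 - w2 * v$1"
  shows "frame_equations w1 w2 w3 \<gamma> (\<lambda>t. heis_coeffs (\<gamma> t) (velocity \<gamma> t))"
proof -
  have "((\<lambda>t. \<gamma> t $ 1) has_real_derivative heis_coeffs (\<gamma> t) (velocity \<gamma> t) $ 1) (at t) \<and>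
     ((\<lambda>t. \<gamma> t $ 2) has_real_derivative heis_coeffs (\<gamma> t) (velocity \<gamma> t) $ 2) (at t) \<and>
     ((\<lambda>t. \<gamma> t $ 3) has_real_derivative heis_coeffs (\<gamma> t) (velocity \<gamma> t) $ 3
        - (\<gamma> t $ 2 * heis_coeffs (\<gamma> t) (velocity \<gamma> t) $ 1 - \<gamma> t $ 1 * heis_coeffs (\<gamma> t) (velocity \<gamma> t) $ 2) / 2) (at t) \<and>
     ((\<lambda>t. heis_coeffs (\<gamma> t) (velocity \<gamma> t) $ 1) has_real_derivative w2 * heis_coeffs (\<gamma> t) (velocity \<gamma> t) $ 3
        - (heis_coeffs (\<gamma> t) (velocity \<gamma> t) $ 3 + w3) * heis_coeffs (\<gamma> t) (velocity \<gamma> t) $ 2) (at t) \<and>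
     ((\<lambda>t. heis_coeffs (\<gamma> t) (velocity \<gamma> t) $ 2) has_real_derivative
        (heis_coeffs (\<gamma> t) (velocity \<gamma> t) $ 3 + w3) * heis_coeffs (\<gamma> t) (velocity \<gamma> t) $ 1 - w1 * heis_coeffs (\<gamma> t) (velocity \<gamma> t) $ 3) (at t) \<and>
     ((\<lambda>t. heis_coeffs (\<gamma> t) (velocity \<gamma> t) $ 3) has_real_derivative
        w1 * heis_coeffs (\<gamma> t) (velocity \<gamma> t) $ 2 - w2 * heis_coeffs (\<gamma> t) (velocity \<gamma> t) $ 1) (at t)" for t
  proof -
    define V where "V = velocity \<gamma>"
    have Vt: "velocity \<gamma> t = V t" for t by (simp add: V_def)
    define A where "A = velocity V t"
    define c where "c = heis_coeffs (\<gamma> t) (V t) $ 3"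
    have dg: "((\<lambda>t. \<gamma> t $ i) has_real_derivative V t $ i) (at t)" for i
    proof (rule vec_nth_derivative)
      have "\<gamma> differentiable (at t)" using traj unfolding magnetic_trajectory_def by blast
      then show "(\<gamma> has_vector_derivative V t) (at t)" unfolding V_def by (rule vector_derivative_works[THEN iffD1])
    qed
    have dV: "((\<lambda>t. V t $ i) has_real_derivative A $ i) (at t)" for i
    proof (rule vec_nth_derivative)
      have "V differentiable (at t)" using traj unfolding magnetic_trajectory_def V_def by blast
      then show "(V has_vector_derivative A) (at t)" unfolding A_def by (rule vector_derivative_works[THEN iffD1])
    qed
    have "A + vector [V t $ 2 * c, - V t $ 1 * c, - (\<gamma> t $ 2 * V t $ 2 + \<gamma> t $ 1 * V t $ 1) * c / 2] = F (\<gamma> t) (V t)"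
    proof -
      have "covariant_acceleration heis_metric \<gamma> t = F (\<gamma> t) (V t)"
        using traj unfolding magnetic_trajectory_def V_def by blast
      then show ?thesis
        unfolding covariant_acceleration_def Vt A_def[symmetric] heis_christoffel_term[OF c_def] .
    qed
    then have Fv: "F (\<gamma> t) (V t) $ 1 = A $ 1 + V t $ 2 * c" "F (\<gamma> t) (V t) $ 2 = A $ 2 - V t $ 1 * c"
      "F (\<gamma> t) (V t) $ 3 = A $ 3 + (- (\<gamma> t $ 2 * V t $ 2) - \<gamma> t $ 1 * V t $ 1) * c / 2"
      by (simp_all add: vec3_eq_iff[of _ "F (\<gamma> t) (V t)"])
    have A1: "A $ 1 = w2 * c - (c + w3) * V t $ 2" and A2: "A $ 2 = (c + w3) * V t $ 1 - w1 * c"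
      and A3: "A $ 3 + (\<gamma> t $ 2 * A $ 1 - \<gamma> t $ 1 * A $ 2) / 2 = w1 * V t $ 2 - w2 * V t $ 1"
      using F1[of "\<gamma> t" "V t", folded c_def, unfolded heis_coeffs_components Fv]
        F2[of "\<gamma> t" "V t", folded c_def, unfolded heis_coeffs_components Fv]
        F3[of "\<gamma> t" "V t", unfolded heis_coeffs_components Fv]
      by (simp_all add: field_simps)
    \<comment> \<open>The terms from differentiating the position cancel, because its derivative is
      \<open>V\<close> itself.\<close>
    have "((\<lambda>t. V t $ 3 + (1/2) * (\<gamma> t $ 2 * V t $ 1 - \<gamma> t $ 1 * V t $ 2)) has_real_derivative w1 * V t $ 2 - w2 * V t $ 1) (at t)"
      by (rule derivative_eq_intros dg dV refl)+ (simp add: A3[symmetric] field_simps)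
    then show ?thesis
      using dg[of 1] dg[of 2] dg[of 3] dV[of 1] dV[of 2] A1 A2
      unfolding Vt by (simp add: heis_coeffs_components c_def)
  qed
  then show ?thesis unfolding frame_equations_def by blast
qed

text \<open>Equal frame velocities fix the first two coordinates up to constants, and the third up
  to a constant and the matching correction of the group product.\<close>

lemma frame_equations_translate:
  assumes 1: "frame_equations w1 w2 w3 \<gamma>1 u1" and 2: "frame_equations w1 w2 w3 \<gamma>2 u2"
    and u: "\<And>t. u2 t = u1 (t + \<tau>)"
  shows "\<exists>a. \<forall>t. \<gamma>2 t = heis_mult a (\<gamma>1 (t + \<tau>))"
proof -
  have d1: "((\<lambda>t. \<gamma>1 (t + \<tau>) $ 1) has_real_derivative u2 t $ 1) (at t)"
    "((\<lambda>t. \<gamma>1 (t + \<tau>) $ 2) has_real_derivative u2 t $ 2) (at t)"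
    "((\<lambda>t. \<gamma>1 (t + \<tau>) $ 3) has_real_derivative u2 t $ 3 - (\<gamma>1 (t + \<tau>) $ 2 * u2 t $ 1 - \<gamma>1 (t + \<tau>) $ 1 * u2 t $ 2) / 2) (at t)" for t
    using 1 unfolding frame_equations_def u by (auto intro!: DERIV_shift[THEN iffD1])
  have d2: "((\<lambda>t. \<gamma>2 t $ 1) has_real_derivative u2 t $ 1) (at t)"
    "((\<lambda>t. \<gamma>2 t $ 2) has_real_derivative u2 t $ 2) (at t)"
    "((\<lambda>t. \<gamma>2 t $ 3) has_real_derivative u2 t $ 3 - (\<gamma>2 t $ 2 * u2 t $ 1 - \<gamma>2 t $ 1 * u2 t $ 2) / 2) (at t)" for t
    using 2 unfolding frame_equations_def by auto
  define a1 where "a1 = \<gamma>2 0 $ 1 - \<gamma>1 (0 + \<tau>) $ 1"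
  define a2 where "a2 = \<gamma>2 0 $ 2 - \<gamma>1 (0 + \<tau>) $ 2"
  have "((\<lambda>t. \<gamma>2 t $ 1 - \<gamma>1 (t + \<tau>) $ 1) has_real_derivative 0) (at t)"
    "((\<lambda>t. \<gamma>2 t $ 2 - \<gamma>1 (t + \<tau>) $ 2) has_real_derivative 0) (at t)" for t
    using DERIV_diff[OF d2(1)[of t] d1(1)[of t]] DERIV_diff[OF d2(2)[of t] d1(2)[of t]] by auto
  from DERIV_isconst_all[OF allI[OF this(1)], of _ 0] DERIV_isconst_all[OF allI[OF this(2)], of _ 0]
  have x: "\<gamma>2 t $ 1 = a1 + \<gamma>1 (t + \<tau>) $ 1" and y: "\<gamma>2 t $ 2 = a2 + \<gamma>1 (t + \<tau>) $ 2" for t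
    unfolding a1_def a2_def by (simp_all add: algebra_simps)
  \<comment> \<open>The third coordinate required of the translating element; since it is constant,
    one element serves all times.\<close>
  define f where "f t = \<gamma>2 t $ 3 - \<gamma>1 (t + \<tau>) $ 3 - (1/2) * (a1 * \<gamma>1 (t + \<tau>) $ 2 - \<gamma>1 (t + \<tau>) $ 1 * a2)" for t
  have "(f has_real_derivative 0) (at t)" for t
    unfolding f_def by (rule derivative_eq_intros d1 d2 refl)+ (simp add: x y field_simps)
  from DERIV_isconst_all[OF allI[OF this], of _ 0] have f: "f t = f 0" for t .
  have "\<gamma>2 t = heis_mult (vector [a1, a2, f 0]) (\<gamma>1 (t + \<tau>))" for t
    using f[of t] x y by (simp add: vec3_eq_iff heis_mult_components f_def)
  then show ?thesis by blast
qed

section \<open>Closed trajectories\<close>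

lemma periodic_bounded:
  fixes f :: "real \<Rightarrow> real"
  assumes "periodic f" "continuous_on UNIV f"
  obtains C where "\<And>t. \<bar>f t\<bar> \<le> C"
proof -
  obtain t1 t2 where "\<And>t. f t1 \<le> f t" "\<And>t. f t \<le> f t2"
    using periodic_attains_extrema[OF assms] by blast
  then have "\<bar>f t\<bar> \<le> \<bar>f t1\<bar> + \<bar>f t2\<bar>" for t by (smt (verit))
  then show ?thesis by (rule that)
qed

lemma frame_equations_D:
  assumes "frame_equations w1 w2 w3 \<gamma> u"
  shows "((\<lambda>t. \<gamma> t $ 1) has_real_derivative u t $ 1) (at t)"
    "((\<lambda>t. \<gamma> t $ 2) has_real_derivative u t $ 2) (at t)"
    "((\<lambda>t. \<gamma> t $ 3) has_real_derivative u t $ 3 - (\<gamma> t $ 2 * u t $ 1 - \<gamma> t $ 1 * u t $ 2) / 2) (at t)"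
    "((\<lambda>t. u t $ 1) has_real_derivative w2 * u t $ 3 - (u t $ 3 + w3) * u t $ 2) (at t)"
    "((\<lambda>t. u t $ 2) has_real_derivative (u t $ 3 + w3) * u t $ 1 - w1 * u t $ 3) (at t)"
    "((\<lambda>t. u t $ 3) has_real_derivative w1 * u t $ 2 - w2 * u t $ 1) (at t)"
  using assms unfolding frame_equations_def by blast+

text \<open>\<open>u\<close> is determined by the position and its derivative, so it inherits the
  period.\<close>

lemma frame_equations_periodic:
  assumes fe: "frame_equations w1 w2 w3 \<gamma> u" and "periodic \<gamma>"
  obtains \<omega> where "\<omega> > 0" "\<And>t. \<gamma> (t + \<omega>) = \<gamma> t" "\<And>t. u (t + \<omega>) = u t"
proof -
  obtain \<omega> where \<omega>: "\<omega> > 0" "\<And>t. \<gamma> (t + \<omega>) = \<gamma> t"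
    using assms(2) by (auto simp: periodic_def)
  note d = frame_equations_D[OF fe]
  have eq: "f' (t + \<omega>) = f' t" if f: "\<And>t. ((\<lambda>t. \<gamma> t $ i) has_real_derivative f' t) (at t)" for f' i t
  proof -
    have "((\<lambda>t. \<gamma> (t + \<omega>) $ i) has_real_derivative f' (t + \<omega>)) (at t)"
      using f by (rule DERIV_shift[THEN iffD1])
    then have "((\<lambda>t. \<gamma> t $ i) has_real_derivative f' (t + \<omega>)) (at t)" by (simp only: \<omega>(2))
    from DERIV_unique[OF this f] show ?thesis .
  qed
  have "u (t + \<omega>) = u t" for t
    using eq[OF d(1), of t] eq[OF d(2), of t] eq[OF d(3), of t] \<omega>(2) by (simp add: vec3_eq_iff)
  then show ?thesis using that \<omega> by blast
qed

lemma frame_energy_constant: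
  assumes "frame_equations w1 w2 w3 \<gamma> u"
  shows "(u t $ 1)^2 + (u t $ 2)^2 + (u t $ 3)^2 = (u 0 $ 1)^2 + (u 0 $ 2)^2 + (u 0 $ 3)^2"
proof -
  have "((\<lambda>t. (u t $ 1)^2 + (u t $ 2)^2 + (u t $ 3)^2) has_real_derivative 0) (at t)" for t
    by (rule derivative_eq_intros frame_equations_D[OF assms] refl)+ (simp add: algebra_simps)
  from DERIV_isconst_all[OF allI[OF this]] show ?thesis .
qed

text \<open>Rotating the horizontal plane so that (w1, w2) lies along the first axis, and rescaling
  time by its length \<open>W\<close>, normalises the horizontal field to length 1.\<close>

lemma frame_equations_reduced:
  assumes fe: "frame_equations w1 w2 w3 \<gamma> u" and "periodic \<gamma>"
    and W: "W > 0" "W^2 = w1^2 + w2^2"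
  obtains K where
    "reduced_orbit (w3/W) (((u 0 $ 1)^2 + (u 0 $ 2)^2 + (u 0 $ 3)^2) / W^2) K
      (\<lambda>t. (u (t/W) $ 3 + w3)/W) (\<lambda>t. (w1 * u (t/W) $ 2 - w2 * u (t/W) $ 1) / W^2)
      (\<lambda>t. (w1 * \<gamma> (t/W) $ 1 + w2 * \<gamma> (t/W) $ 2) / W)"
    "\<And>t. (w1 * u (t/W) $ 1 + w2 * u (t/W) $ 2) / W^2 = K - ((u (t/W) $ 3 + w3)/W)^2 / 2"
proof -
  note d = frame_equations_D[OF fe]
  have scale: "((\<lambda>t. f (t/W)) has_real_derivative f' / W) (at t)" if "(f has_real_derivative f') (at (t/W))" for f f' and t :: real
  proof -
    have "((\<lambda>t. t/W) has_real_derivative 1/W) (at t)" by (rule DERIV_cdivide[OF DERIV_ident])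
    from DERIV_chain2[OF _ this, of f, OF that] show ?thesis by simp
  qed
  define s where "s t = (u (t/W) $ 3 + w3)/W" for t
  define p where "p t = (w1 * u (t/W) $ 2 - w2 * u (t/W) $ 1) / W^2" for t
  define b where "b t = (w1 * u (t/W) $ 1 + w2 * u (t/W) $ 2) / W^2" for t
  define X where "X t = (w1 * \<gamma> (t/W) $ 1 + w2 * \<gamma> (t/W) $ 2) / W" for t
  have ds: "(s has_real_derivative p t) (at t)" for t
  proof -
    have "((\<lambda>t. (u t $ 3 + w3) / W) has_real_derivative (w1 * u (t/W) $ 2 - w2 * u (t/W) $ 1) / W) (at (t/W))"
      by (rule derivative_eq_intros d refl)+ (use W(1) in \<open>simp_all add: field_simps\<close>)
    from scale[OF this] show ?thesis by (simp add: s_def[abs_def] p_def power2_eq_square mult.assoc)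
  qed
  have db: "(b has_real_derivative - (s t * p t)) (at t)" for t
  proof -
    have "((\<lambda>t. (w1 * u t $ 1 + w2 * u t $ 2) / W^2) has_real_derivative
        - ((u (t/W) $ 3 + w3) * (w1 * u (t/W) $ 2 - w2 * u (t/W) $ 1)) / W^2) (at (t/W))"
      by (rule derivative_eq_intros d refl)+ (use W(1) in \<open>simp_all add: field_simps\<close>)
    from scale[OF this] show ?thesis by (simp add: b_def[abs_def] s_def p_def power2_eq_square mult.assoc)
  qed
  have dX: "(X has_real_derivative b t) (at t)" for t
  proof -
    have "((\<lambda>t. (w1 * \<gamma> t $ 1 + w2 * \<gamma> t $ 2) / W) has_real_derivative (w1 * u (t/W) $ 1 + w2 * u (t/W) $ 2) / W) (at (t/W))"
      by (rule derivative_eq_intros d refl)+ (use W(1) in \<open>simp_all add: field_simps\<close>)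
    from scale[OF this] show ?thesis by (simp add: X_def[abs_def] b_def power2_eq_square mult.assoc)
  qed
  have dp: "(p has_real_derivative s t * b t - (s t - w3/W)) (at t)" for t
  proof -
    have "((\<lambda>t. (w1 * u t $ 2 - w2 * u t $ 1) / W^2) has_real_derivative
        ((u (t/W) $ 3 + w3) * (w1 * u (t/W) $ 1 + w2 * u (t/W) $ 2) - (w1^2 + w2^2) * u (t/W) $ 3) / W^2) (at (t/W))"
      by (rule derivative_eq_intros d refl)+ (use W(1) in \<open>simp_all add: field_simps power2_eq_square\<close>)
    from scale[OF this[folded W(2)]] have "(p has_real_derivative
        ((u (t/W) $ 3 + w3) * (w1 * u (t/W) $ 1 + w2 * u (t/W) $ 2) - W^2 * u (t/W) $ 3) / W^2 / W) (at t)"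
      by (simp add: p_def[abs_def])
    moreover have "((u (t/W) $ 3 + w3) * (w1 * u (t/W) $ 1 + w2 * u (t/W) $ 2) - W^2 * u (t/W) $ 3) / W^2 / W
        = s t * b t - (s t - w3/W)"
      using W(1) by (simp add: s_def b_def field_simps power2_eq_square)
    ultimately show ?thesis by simp
  qed
  \<comment> \<open>The conserved quantity that expresses the velocity along (w1, w2) through
    \<open>s\<close>.\<close>
  define K where "K = b 0 + (s 0)^2 / 2"
  have "((\<lambda>t. b t + (s t)^2 / 2) has_real_derivative 0) (at t)" for t
    using DERIV_add[OF db[of t] DERIV_cdivide[OF DERIV_power[OF ds[of t], of 2], of 2]] by (simp add: mult.commute)
  from DERIV_isconst_all[OF allI[OF this], of _ 0] have b: "b t = K - (s t)^2 / 2" for t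
    by (simp add: K_def algebra_simps)
  obtain \<omega> where \<omega>: "\<omega> > 0" "\<And>t. \<gamma> (t + \<omega>) = \<gamma> t" "\<And>t. u (t + \<omega>) = u t"
    using frame_equations_periodic[OF fe \<open>periodic \<gamma>\<close>] by blast
  have shift: "(t + W * \<omega>) / W = t / W + \<omega>" for t using W(1) by (simp add: field_simps)
  have per: "periodic s" "periodic X"
    unfolding periodic_def s_def X_def using W(1) \<omega> by (auto intro!: exI[of _ "W * \<omega>"] simp: shift)
  have "continuous_on UNIV X" using dX by (meson DERIV_continuous_on has_field_derivative_at_within)
  then obtain C where C: "\<And>t. \<bar>X t\<bar> \<le> C" using periodic_bounded[OF per(2)] by blast
  have energy: "(p t)^2 + (b t)^2 + (s t - w3/W)^2 = ((u 0 $ 1)^2 + (u 0 $ 2)^2 + (u 0 $ 3)^2) / W^2" for t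
  proof -
    \<comment> \<open>Lagrange's identity for the horizontal parts of field and velocity.\<close>
    have "(p t)^2 + (b t)^2 = ((w1^2 + w2^2) * ((u (t/W) $ 1)^2 + (u (t/W) $ 2)^2)) / (W^2)^2"
      by (simp add: p_def b_def power_divide add_divide_distrib[symmetric]) (simp add: power2_eq_square algebra_simps)
    also have "\<dots> = ((u (t/W) $ 1)^2 + (u (t/W) $ 2)^2) / W^2"
      using W(1) unfolding W(2)[symmetric] by (simp add: power2_eq_square)
    finally have "(p t)^2 + (b t)^2 + (s t - w3/W)^2 = ((u (t/W) $ 1)^2 + (u (t/W) $ 2)^2 + (u (t/W) $ 3)^2) / W^2"
      by (simp add: s_def power_divide add_divide_distrib)
    then show ?thesis using frame_energy_constant[OF fe, of "t/W"] by simp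
  qed
  have "reduced_orbit (w3/W) (((u 0 $ 1)^2 + (u 0 $ 2)^2 + (u 0 $ 3)^2) / W^2) K s p X"
    unfolding reduced_orbit_def b[symmetric] using ds dp dX energy per(1) C by blast
  then show ?thesis using that b unfolding s_def p_def X_def b_def by blast
qed

text \<open>\<open>reduced_orbit_unique\<close> matches \<open>s\<close>, \<open>p\<close> and
  \<open>K\<close>. These determine all of \<open>u\<close>, since its two horizontal combinations
  form a linear system with nonzero determinant.\<close>

lemma frames_coincide_of_horizontal_component:
  assumes f1: "frame_equations w1 w2 w3 \<gamma>1 u1" and f2: "frame_equations w1 w2 w3 \<gamma>2 u2"
    and per: "periodic \<gamma>1" "periodic \<gamma>2" and w: "w1^2 + w2^2 \<noteq> 0"
    and en: "(u1 0 $ 1)^2 + (u1 0 $ 2)^2 + (u1 0 $ 3)^2 = (u2 0 $ 1)^2 + (u2 0 $ 2)^2 + (u2 0 $ 3)^2"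
  shows "\<exists>\<tau>. \<forall>t. u2 t = u1 (t + \<tau>)"
proof -
  define W where "W = sqrt (w1^2 + w2^2)"
  have "0 < w1^2 + w2^2" using w by (metis add_nonneg_nonneg order_le_less zero_le_power2)
  then have W: "W > 0" "W^2 = w1^2 + w2^2" by (simp_all add: W_def)
  obtain K1 where o1: "reduced_orbit (w3/W) (((u1 0 $ 1)^2 + (u1 0 $ 2)^2 + (u1 0 $ 3)^2) / W^2) K1
      (\<lambda>t. (u1 (t/W) $ 3 + w3)/W) (\<lambda>t. (w1 * u1 (t/W) $ 2 - w2 * u1 (t/W) $ 1) / W^2)
      (\<lambda>t. (w1 * \<gamma>1 (t/W) $ 1 + w2 * \<gamma>1 (t/W) $ 2) / W)"
    and b1: "\<And>t. (w1 * u1 (t/W) $ 1 + w2 * u1 (t/W) $ 2) / W^2 = K1 - ((u1 (t/W) $ 3 + w3)/W)^2 / 2"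
    using frame_equations_reduced[OF f1 per(1) W] by blast
  obtain K2 where o2: "reduced_orbit (w3/W) (((u2 0 $ 1)^2 + (u2 0 $ 2)^2 + (u2 0 $ 3)^2) / W^2) K2
      (\<lambda>t. (u2 (t/W) $ 3 + w3)/W) (\<lambda>t. (w1 * u2 (t/W) $ 2 - w2 * u2 (t/W) $ 1) / W^2)
      (\<lambda>t. (w1 * \<gamma>2 (t/W) $ 1 + w2 * \<gamma>2 (t/W) $ 2) / W)"
    and b2: "\<And>t. (w1 * u2 (t/W) $ 1 + w2 * u2 (t/W) $ 2) / W^2 = K2 - ((u2 (t/W) $ 3 + w3)/W)^2 / 2"
    using frame_equations_reduced[OF f2 per(2) W] by blast
  from reduced_orbit_unique[OF o1 o2[folded en]] obtain \<tau> where K: "K1 = K2"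
    and \<tau>: "\<And>t. (u2 (t/W) $ 3 + w3)/W = (u1 ((t + \<tau>)/W) $ 3 + w3)/W"
      "\<And>t. (w1 * u2 (t/W) $ 2 - w2 * u2 (t/W) $ 1) / W^2 = (w1 * u1 ((t + \<tau>)/W) $ 2 - w2 * u1 ((t + \<tau>)/W) $ 1) / W^2"
    by blast
  have "u2 t = u1 (t + \<tau>/W)" for t
  proof -
    let ?v = "u1 (t + \<tau>/W)"
    have t: "(W * t) / W = t" "(W * t + \<tau>) / W = t + \<tau>/W" using W(1) by (simp_all add: field_simps)
    have 3: "u2 t $ 3 = ?v $ 3" using \<tau>(1)[of "W * t"] W(1) unfolding t by simp
    have p: "w1 * u2 t $ 2 - w2 * u2 t $ 1 = w1 * ?v $ 2 - w2 * ?v $ 1"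
      using \<tau>(2)[of "W * t"] W(1) unfolding t by simp
    have "(w1 * u2 t $ 1 + w2 * u2 t $ 2) / W^2 = (w1 * ?v $ 1 + w2 * ?v $ 2) / W^2"
      using b1[of "W * t + \<tau>"] b2[of "W * t"] unfolding t K 3 by simp
    then have b: "w1 * u2 t $ 1 + w2 * u2 t $ 2 = w1 * ?v $ 1 + w2 * ?v $ 2" using W(1) by simp
    have "W^2 * (u2 t $ 1 - ?v $ 1) = 0" "W^2 * (u2 t $ 2 - ?v $ 2) = 0"
      unfolding W(2) using p b by algebra+
    then show ?thesis using 3 W(1) by (simp add: vec3_eq_iff)
  qed
  then show ?thesis by blast
qed

section \<open>Forces without horizontal component\<close>

lemma rotating_frame:
  assumes fe: "frame_equations 0 0 w3 \<gamma> u"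
  shows "\<exists>c \<alpha>. 0 \<le> c \<and> c^2 = (u 0 $ 1)^2 + (u 0 $ 2)^2 \<and> (\<forall>t. u t $ 1 = c * cos ((u 0 $ 3 + w3) * t + \<alpha>)
    \<and> u t $ 2 = c * sin ((u 0 $ 3 + w3) * t + \<alpha>) \<and> u t $ 3 = u 0 $ 3)"
proof -
  note d = frame_equations_D[OF fe]
  have "((\<lambda>t. u t $ 3) has_real_derivative 0) (at t)" for t using d(6)[of t] by simp
  from DERIV_isconst_all[OF allI[OF this], of _ 0] have u3: "u t $ 3 = u 0 $ 3" for t .
  define s where "s = u 0 $ 3 + w3"
  obtain r a where ra: "u 0 $ 1 = r * cos a" "u 0 $ 2 = r * sin a"
    using polar_Ex[of "u 0 $ 1" "u 0 $ 2"] by blast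
  \<comment> \<open>A half turn of the phase makes the amplitude nonnegative, so that equal squares
    later give equal amplitudes.\<close>
  define c where "c = \<bar>r\<bar>"
  define \<alpha> where "\<alpha> = (if 0 \<le> r then a else a + pi)"
  have \<alpha>: "u 0 $ 1 = c * cos \<alpha>" "u 0 $ 2 = c * sin \<alpha>"
    by (simp_all add: ra c_def \<alpha>_def)
  have c2: "c^2 = (u 0 $ 1)^2 + (u 0 $ 2)^2"
    by (simp add: ra c_def power_mult_distrib flip: distrib_left)
  have "u t $ 2 = c * sin (s * t + \<alpha>) \<and> u t $ 1 = c * cos (s * t + \<alpha>)" for t
  proof (rule second_order_ode_unique[where \<theta> = "\<lambda>_. s" and G = "\<lambda>x. - x" and ?t0.0 = 0
        and ?s1.0 = "\<lambda>t. u t $ 2" and ?p1.0 = "\<lambda>t. u t $ 1"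
        and ?s2.0 = "\<lambda>t. c * sin (s * t + \<alpha>)" and ?p2.0 = "\<lambda>t. c * cos (s * t + \<alpha>)"])
    show "((\<lambda>t. u t $ 2) has_real_derivative s * u t $ 1) (at t)" for t
      using d(5)[of t] u3[of t] by (simp add: s_def)
    show "((\<lambda>t. u t $ 1) has_real_derivative s * - u t $ 2) (at t)" for t
      using d(4)[of t] u3[of t] by (simp add: s_def)
    show "((\<lambda>t. c * sin (s * t + \<alpha>)) has_real_derivative s * (c * cos (s * t + \<alpha>))) (at t)" for t
      by (rule derivative_eq_intros refl)+ simp
    show "((\<lambda>t. c * cos (s * t + \<alpha>)) has_real_derivative s * - (c * sin (s * t + \<alpha>))) (at t)" for t
      by (rule derivative_eq_intros refl)+ simp
    show "\<exists>L. \<forall>a b. \<bar>a\<bar> \<le> M \<longrightarrow> \<bar>b\<bar> \<le> M \<longrightarrow> \<bar>- a - - b\<bar> \<le> L * \<bar>a - b\<bar>" for M :: real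
      by (rule exI[of _ 1]) auto
  qed (use \<alpha> in auto)
  moreover have "0 \<le> c" by (simp add: c_def)
  ultimately show ?thesis using u3 c2 unfolding s_def by blast
qed

text \<open>For a force without horizontal component the curve projects to a circle traversed with
  constant angular velocity \<open>u\<^sub>3 + w\<^sub>3\<close>; the area it encloses must balance the vertical drift.\<close>

lemma rotating_frame_closure:
  assumes fe: "frame_equations 0 0 w3 \<gamma> u" and "periodic \<gamma>"
  shows "2 * u 0 $ 3 * (u 0 $ 3 + w3) + (u 0 $ 1)^2 + (u 0 $ 2)^2 = 0"
proof -
  note d = frame_equations_D[OF fe]
  obtain c \<alpha> where c: "c^2 = (u 0 $ 1)^2 + (u 0 $ 2)^2" and rot: "\<forall>t. u t $ 1 = c * cos ((u 0 $ 3 + w3) * t + \<alpha>)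
    \<and> u t $ 2 = c * sin ((u 0 $ 3 + w3) * t + \<alpha>) \<and> u t $ 3 = u 0 $ 3"
    using rotating_frame[OF fe] by blast
  define v where "v = u 0 $ 3"
  define s where "s = v + w3"
  have u: "u t $ 1 = c * cos (s * t + \<alpha>)" "u t $ 2 = c * sin (s * t + \<alpha>)" "u t $ 3 = v" for t
    using spec[OF rot, of t] unfolding s_def v_def by simp_all
  have bdd: "\<exists>C. \<forall>t. \<bar>\<gamma> t $ i\<bar> \<le> C" if "\<And>t. ((\<lambda>t. \<gamma> t $ i) has_real_derivative f' t) (at t)" for i f'
  proof -
    have per: "periodic (\<lambda>t. \<gamma> t $ i)" using \<open>periodic \<gamma>\<close> by (auto simp: periodic_def)
    have "continuous_on UNIV (\<lambda>t. \<gamma> t $ i)" by (rule DERIV_continuous_on) (rule has_field_derivative_at_within[OF that])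
    from periodic_bounded[OF per this] show ?thesis by blast
  qed
  obtain C1 C2 C3 where C: "\<And>t. \<bar>\<gamma> t $ 1\<bar> \<le> C1" "\<And>t. \<bar>\<gamma> t $ 2\<bar> \<le> C2" "\<And>t. \<bar>\<gamma> t $ 3\<bar> \<le> C3"
    using bdd[OF d(1)] bdd[OF d(2)] bdd[OF d(3)] by blast
  have "2 * v * s + c^2 = 0"
  proof (cases "s = 0")
    \<comment> \<open>Without rotation the horizontal velocity is constant, and boundedness forces
      it to vanish.\<close>
    case True
    have "u 0 $ 1 = 0"
      by (rule zero_of_bounded_constant_derivative[of "\<lambda>t. \<gamma> t $ 1", OF _ C(1)]) (use d(1) u(1) True in simp)
    moreover have "u 0 $ 2 = 0"
      by (rule zero_of_bounded_constant_derivative[of "\<lambda>t. \<gamma> t $ 2", OF _ C(2)]) (use d(2) u(2) True in simp)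
    ultimately show ?thesis using True c by simp
  next
    case False
    \<comment> \<open>\<open>x0\<close> and \<open>y0\<close> are the centre of the projected
      circle.\<close>
    define x0 where "x0 = \<gamma> 0 $ 1 - u 0 $ 2 / s"
    define y0 where "y0 = \<gamma> 0 $ 2 + u 0 $ 1 / s"
    have du: "((\<lambda>t. u t $ 1) has_real_derivative - (s * u t $ 2)) (at t)" "((\<lambda>t. u t $ 2) has_real_derivative s * u t $ 1) (at t)" for t
      using d(4)[of t] d(5)[of t] u(3)[of t] by (simp_all add: s_def)
    have "((\<lambda>t. \<gamma> t $ 1 - u t $ 2 / s) has_real_derivative 0) (at t)" "((\<lambda>t. \<gamma> t $ 2 + u t $ 1 / s) has_real_derivative 0) (at t)" for t
      using DERIV_diff[OF d(1)[of t] DERIV_cdivide[OF du(2)[of t], of s]]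
        DERIV_add[OF d(2)[of t] DERIV_cdivide[OF du(1)[of t], of s]] False by simp_all
    from DERIV_isconst_all[OF allI[OF this(1)], of _ 0] DERIV_isconst_all[OF allI[OF this(2)], of _ 0]
    have x: "\<gamma> t $ 1 = x0 + u t $ 2 / s" and y: "\<gamma> t $ 2 = y0 - u t $ 1 / s" for t
      unfolding x0_def y0_def by (simp_all add: algebra_simps)
    have cc: "(u t $ 1)^2 + (u t $ 2)^2 = c^2" for t
      by (simp add: u power_mult_distrib flip: distrib_left)
    \<comment> \<open>Up to a constant, the third coordinate after left translation of that centre
      to the origin. Its derivative is constant, vertical velocity plus rate of swept area, so
      boundedness makes it zero.\<close>
    define Z where "Z t = \<gamma> t $ 3 + (y0 * \<gamma> t $ 1 - x0 * \<gamma> t $ 2) / 2" for t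
    have dZ: "(Z has_real_derivative v + c^2 / (2 * s)) (at t)" for t
    proof -
      have "(Z has_real_derivative (u t $ 3 - (\<gamma> t $ 2 * u t $ 1 - \<gamma> t $ 1 * u t $ 2) / 2) + (y0 * u t $ 1 - x0 * u t $ 2) / 2) (at t)"
        unfolding Z_def by (intro DERIV_add DERIV_cdivide DERIV_diff DERIV_cmult d(1-3))
      moreover have "(u t $ 3 - (\<gamma> t $ 2 * u t $ 1 - \<gamma> t $ 1 * u t $ 2) / 2) + (y0 * u t $ 1 - x0 * u t $ 2) / 2 = v + c^2 / (2 * s)"
        unfolding x y u(3) cc[of t, symmetric] using False by (simp add: field_simps power2_eq_square)
      ultimately show ?thesis by simp
    qed
    have "\<bar>Z t\<bar> \<le> C3 + (\<bar>y0\<bar> * C1 + \<bar>x0\<bar> * C2) / 2" for t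
    proof -
      have "\<bar>y0 * \<gamma> t $ 1\<bar> \<le> \<bar>y0\<bar> * C1" "\<bar>x0 * \<gamma> t $ 2\<bar> \<le> \<bar>x0\<bar> * C2"
        unfolding abs_mult using C by (intro mult_left_mono; simp)+
      moreover have "\<bar>z + (p - q) / 2\<bar> \<le> c + (a + b) / 2" if "\<bar>p\<bar> \<le> a" "\<bar>q\<bar> \<le> b" "\<bar>z\<bar> \<le> c" for z p q a b c :: real
        using that by (auto simp: abs_le_iff field_simps)
      ultimately show ?thesis unfolding Z_def using C(3) by blast
    qed
    from zero_of_bounded_constant_derivative[OF dZ this] show ?thesis using False by (simp add: field_simps)
  qed
  then show ?thesis using c by (simp add: s_def v_def)
qed

text \<open>The closing relation and the energy fix the vertical component, then the horizontal
  amplitude; the remaining phase difference is a time shift.\<close>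

lemma frames_coincide_vertical:
  assumes f1: "frame_equations 0 0 w3 \<gamma>1 u1" and f2: "frame_equations 0 0 w3 \<gamma>2 u2"
    and per: "periodic \<gamma>1" "periodic \<gamma>2"
    and en: "(u1 0 $ 1)^2 + (u1 0 $ 2)^2 + (u1 0 $ 3)^2 = (u2 0 $ 1)^2 + (u2 0 $ 2)^2 + (u2 0 $ 3)^2"
  shows "\<exists>\<tau>. \<forall>t. u2 t = u1 (t + \<tau>)"
proof -
  obtain c1 \<alpha>1 where c1: "0 \<le> c1" "c1^2 = (u1 0 $ 1)^2 + (u1 0 $ 2)^2"
    and rot1: "\<forall>t. u1 t $ 1 = c1 * cos ((u1 0 $ 3 + w3) * t + \<alpha>1) \<and>
      u1 t $ 2 = c1 * sin ((u1 0 $ 3 + w3) * t + \<alpha>1) \<and> u1 t $ 3 = u1 0 $ 3"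
    using rotating_frame[OF f1] by blast
  obtain c2 \<alpha>2 where c2: "0 \<le> c2" "c2^2 = (u2 0 $ 1)^2 + (u2 0 $ 2)^2"
    and rot2: "\<forall>t. u2 t $ 1 = c2 * cos ((u2 0 $ 3 + w3) * t + \<alpha>2) \<and>
      u2 t $ 2 = c2 * sin ((u2 0 $ 3 + w3) * t + \<alpha>2) \<and> u2 t $ 3 = u2 0 $ 3"
    using rotating_frame[OF f2] by blast
  define v where "v = u1 0 $ 3"
  define v' where "v' = u2 0 $ 3"
  define e where "e = c1^2 + v^2"
  have e: "e = c2^2 + v'^2" using en by (simp add: e_def v_def v'_def c1(2) c2(2))
  have closed: "2 * v * (v + w3) + c1^2 = 0" "2 * v' * (v' + w3) + c2^2 = 0"
    using rotating_frame_closure[OF f1 per(1)] rotating_frame_closure[OF f2 per(2)]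
    by (simp_all add: v_def v'_def c1(2) c2(2))
  txt \<open>Both \<open>v\<close> and \<open>v'\<close> are roots of \<open>X\<^sup>2 + 2 w\<^sub>3 X + e\<close>, and neither exceeds \<open>\<surd>e\<close> in absolute
    value, while two distinct roots would have product \<open>e\<close>.\<close>
  have "v = v'"
  proof (rule ccontr)
    assume ne: "v \<noteq> v'"
    have "(v - v') * (v + v' + 2 * w3) = 0"
      using closed e unfolding e_def by algebra
    then have "2 * w3 = - (v + v')" using ne by auto
    then have "v * v' = e" using closed(1) unfolding e_def by algebra
    then have "(v - v')^2 = - (c1^2 + c2^2)" using e unfolding e_def by algebra
    then have "(v - v')^2 \<le> 0" by simp
    then show False using ne by simp
  qed
  then have c: "c1 = c2" using e c1(1) c2(1) unfolding e_def by (simp add: power2_eq_iff_nonneg)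
  define s where "s = v + w3"
  \<comment> \<open>For \<open>s = 0\<close> the quotient is 0 by convention, but then the closing
    relation gives \<open>c1 = 0\<close> and any shift works.\<close>
  have "u2 t = u1 (t + (\<alpha>2 - \<alpha>1) / s)" for t
  proof (cases "s = 0")
    case True
    then have "c1 = 0" using closed(1) by (simp add: s_def)
    then show ?thesis using c \<open>v = v'\<close> spec[OF rot1, of "t + (\<alpha>2 - \<alpha>1) / s"] spec[OF rot2, of t]
      unfolding v_def v'_def vec3_eq_iff by (simp only:) simp
  next
    case False
    then have "s * (t + (\<alpha>2 - \<alpha>1) / s) + \<alpha>1 = s * t + \<alpha>2" by (simp add: field_simps)
    then show ?thesis using c \<open>v = v'\<close> spec[OF rot1, of "t + (\<alpha>2 - \<alpha>1) / s"] spec[OF rot2, of t]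
      unfolding s_def v_def v'_def vec3_eq_iff by (simp only:)
  qed
  then show ?thesis by blast
qed

theorem theorem3p10:
  fixes F :: "real ^ 3 \<Rightarrow> real ^ 3 \<Rightarrow> real ^ 3"
    and \<sigma>1 \<sigma>2 :: "real \<Rightarrow> real ^ 3"
  assumes "left_invariant_lorentz_force F"
    and "magnetic_trajectory F \<sigma>1" and "periodic \<sigma>1"
    and "magnetic_trajectory F \<sigma>2" and "periodic \<sigma>2"
    and "energy \<sigma>1 = energy \<sigma>2"
  shows "\<exists>\<psi> r s. (\<psi>, r) \<in> isotropy F \<and> \<sigma>2 = act_curve_shift ((\<psi>, r), s) \<sigma>1"
proof -
  obtain w1 w2 w3 where w: "\<forall>p v. heis_coeffs p (F p v) $ 1 = w2 * heis_coeffs p v $ 3 - w3 * v$2 \<and>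
    heis_coeffs p (F p v) $ 2 = w3 * v$1 - w1 * heis_coeffs p v $ 3 \<and>
    heis_coeffs p (F p v) $ 3 = w1 * v$2 - w2 * v$1"
    using lorentz_force_frame[OF assms(1)] by blast
  then have F: "heis_coeffs p (F p v) $ 1 = w2 * heis_coeffs p v $ 3 - w3 * v$2"
    "heis_coeffs p (F p v) $ 2 = w3 * v$1 - w1 * heis_coeffs p v $ 3"
    "heis_coeffs p (F p v) $ 3 = w1 * v$2 - w2 * v$1" for p v by blast+
  define u where "u \<gamma> t = heis_coeffs (\<gamma> t) (velocity \<gamma> t)" for \<gamma> t
  have f1: "frame_equations w1 w2 w3 \<sigma>1 (u \<sigma>1)" and f2: "frame_equations w1 w2 w3 \<sigma>2 (u \<sigma>2)"
    using magnetic_trajectory_frame_equations[OF assms(2) F] magnetic_trajectory_frame_equations[OF assms(4) F]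
    unfolding u_def by auto
  \<comment> \<open>The frame is orthonormal, so the energy is half the squared Euclidean norm of
    the frame velocity.\<close>
  have en: "(u \<sigma>1 0 $ 1)^2 + (u \<sigma>1 0 $ 2)^2 + (u \<sigma>1 0 $ 3)^2 = (u \<sigma>2 0 $ 1)^2 + (u \<sigma>2 0 $ 2)^2 + (u \<sigma>2 0 $ 3)^2"
    using assms(6) by (simp add: energy_def heis_metric_def u_def inner_vec_def sum_3 power2_eq_square)
  have "\<exists>\<tau>. \<forall>t. u \<sigma>2 t = u \<sigma>1 (t + \<tau>)"
  proof (cases "w1^2 + w2^2 = 0")
    case True
    then have "w1 = 0" "w2 = 0" by (simp_all add: sum_power2_eq_zero_iff)
    then show ?thesis using frames_coincide_vertical f1 f2 assms(3,5) en by blast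
  next
    case False
    then show ?thesis using frames_coincide_of_horizontal_component[OF f1 f2 assms(3,5) _ en] by blast
  qed
  then obtain \<tau> where "\<And>t. u \<sigma>2 t = u \<sigma>1 (t + \<tau>)" by blast
  from frame_equations_translate[OF f1 f2 this] obtain a where "\<And>t. \<sigma>2 t = heis_mult a (\<sigma>1 (t + \<tau>))" by blast
  then have "\<sigma>2 = act_curve_shift ((heis_mult a, 1), \<tau>) \<sigma>1" by auto
  moreover have "(heis_mult a, 1) \<in> isotropy F"
    using assms(1) heis_mult_in_isotropy by (simp add: left_invariant_lorentz_force_def)
  ultimately show ?thesis by blast
qed

end
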